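(* Let $\mathbb F_q$ be a finite field of characteristic two. Let $\sigma\in\mathbb F_q$ have absolute trace $1$, and if $q$ is a square let $\theta$ be a non-cube in $\mathbb F_q$. Then any cubic rational expression $R(x)$ over $\mathbb F_q$ is equivalent over $\mathbb F_q$ to precisely one of the following: (i) $x^3$, with ramification indices $(3,3)$; (ii) $\dfrac{x^3+\sigma x+\sigma}{x^2+x+\sigma+1}$, with ramification indices $(3,3)$; (iii) $x^3+x^2$, with ramification indices $(3,2)$; (iv) $(x^3+1)/x$ or, only in case $q$ is a square, $(x^3+\theta)/x$ or $(x^3+\theta^2)/x$, all with ramification indices $(2)$; (v) $(x^3+c)/(x+c)$, with ramification indices $(2,2)$, for a unique $c\in\mathbb F_q\setminus\mathbb F_2$; (vi) $\dfrac{x^3+bx^2+\sigma x+(b+1)\sigma}{x^2+x+b+1+\sigma}$, with ramification indices $(2,2)$, for a unique $b\in\mathbb F_q\setminus\mathbb F_2$.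
   Context: A rational expression $R(x)=g(x)/h(x)$ with $g,h$ coprime has degree $\max(\deg g,\deg h)$; cubic means degree $3$. The group $G(\mathbb F_q)=\mathrm{PGL}_2(\mathbb F_q)\times\mathrm{PGL}_2(\mathbb F_q)$, with $\mathrm{PGL}_2(\mathbb F_q)$ identified with the group of degree-one rational expressions (Möbius transformations) over $\mathbb F_q$ under composition, acts on $\mathbb F_q(x)$ by $(B,A)\cdot R(x)=B(R(A^{-1}(x)))$; two expressions are equivalent over $\mathbb F_q$ if they lie in the same $G(\mathbb F_q)$-orbit. The absolute trace of $\sigma$ is $\sigma+\sigma^2+\sigma^4+\cdots+\sigma^{q/2}$. Viewing $R$ as a map $\mathbb P^1(\overline{\mathbb F}_q)\to\mathbb P^1(\overline{\mathbb F}_q)$, the ramification index $e_R(P)$ is the multiplicity of $P$ in the fibre $R^{-1}(R(P))$; the listed ramification indices are the values $e_R(P)>1$ over all ramification points $P$. *)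

theory Defs
  imports
    "HOL-Algebra.Group_Action"
    "HOL-Algebra.Algebraic_Closure_Type"
    "HOL-Computational_Algebra.Fraction_Field"
    "HOL-Library.Cardinality"
    "HOL-Library.Multiset"
begin

section \<open>Rational expressions\<close>

text \<open>
  The field of rational expressions over \<^typ>\<open>'a\<close> is \<^typ>\<open>'a poly fract\<close>. A representation in
  lowest terms is unique up to a common nonzero constant factor, and nothing below depends on the
  one that is chosen.
\<close>

definition lowest_terms :: "'a::field poly fract \<Rightarrow> 'a poly \<times> 'a poly" where
  "lowest_terms R = (SOME (g, h). h \<noteq> 0 \<and> coprime g h \<and> R = Fract g h)"

definition numer :: "'a::field poly fract \<Rightarrow> 'a poly" where
  "numer R = fst (lowest_terms R)"

definition denom :: "'a::field poly fract \<Rightarrow> 'a poly" where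
  "denom R = snd (lowest_terms R)"

definition rat_degree :: "'a::field poly fract \<Rightarrow> nat" where
  "rat_degree R = max (Polynomial.degree (numer R)) (Polynomial.degree (denom R))"

definition rat_X :: "'a::field poly fract" where
  "rat_X = Fract [:0, 1:] 1"

definition poly_at_rat :: "'a::field poly \<Rightarrow> 'a poly fract \<Rightarrow> 'a poly fract" where
  "poly_at_rat p S = poly (map_poly (\<lambda>a. Fract [:a:] 1) p) S"

text \<open>
  \<open>rat_comp R S\<close> is \<open>R(S(x))\<close>. The denominator is nonzero whenever \<open>S\<close> is nonconstant, which is the
  only case that matters here.
\<close>

definition rat_comp :: "'a::field poly fract \<Rightarrow> 'a poly fract \<Rightarrow> 'a poly fract" where
  "rat_comp R S = poly_at_rat (numer R) S / poly_at_rat (denom R) S"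

section \<open>Equivalence of rational expressions\<close>

definition PGL2 :: "'a::field poly fract monoid" where
  "PGL2 = \<lparr>carrier = {A. rat_degree A = 1}, monoid.mult = rat_comp, one = rat_X\<rparr>"

definition rat_action ::
    "'a::field poly fract \<times> 'a poly fract \<Rightarrow> 'a poly fract \<Rightarrow> 'a poly fract" where
  "rat_action = (\<lambda>(B, A) R. rat_comp B (rat_comp R (inv\<^bsub>PGL2\<^esub> A)))"

text \<open>
  The value of \<open>B\<close> at a constant expression may be the point at infinity, which is not an element of
  \<^typ>\<open>'a poly fract\<close>, so \<^const>\<open>rat_action\<close> is meaningful only on nonconstant expressions.
\<close>

definition rat_equivalent :: "'a::field poly fract \<Rightarrow> 'a poly fract \<Rightarrow> bool" where
  "rat_equivalent R S \<longleftrightarrow> S \<in> orbit (PGL2 \<times>\<times> PGL2) rat_action R"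

section \<open>Ramification over the algebraic closure\<close>

datatype 'b proj_line = Fin 'b | Infty

definition numer_ac :: "'a::field poly fract \<Rightarrow> 'a alg_closure poly" where
  "numer_ac R = map_poly to_ac (numer R)"

definition denom_ac :: "'a::field poly fract \<Rightarrow> 'a alg_closure poly" where
  "denom_ac R = map_poly to_ac (denom R)"

text \<open>
  Numerator and denominator are regarded as binary forms of degree \<open>n = rat_degree R\<close>. The value of
  such a form at \<open>(1 : 0)\<close> is its coefficient of index \<open>n\<close>, and the order of vanishing there is \<open>n\<close>
  minus the degree of the dehomogenised polynomial.
\<close>

definition rat_map :: "'a::field poly fract \<Rightarrow> 'a alg_closure proj_line \<Rightarrow> 'a alg_closure proj_line" where
  "rat_map R P =
    (let u = (case P of Fin a \<Rightarrow> poly (numer_ac R) a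
                      | Infty \<Rightarrow> Polynomial.coeff (numer_ac R) (rat_degree R));
         v = (case P of Fin a \<Rightarrow> poly (denom_ac R) a
                      | Infty \<Rightarrow> Polynomial.coeff (denom_ac R) (rat_degree R))
     in if v = 0 then Infty else Fin (u / v))"

definition fibre_poly :: "'a::field poly fract \<Rightarrow> 'a alg_closure proj_line \<Rightarrow> 'a alg_closure poly" where
  "fibre_poly R Q =
    (case Q of Fin v \<Rightarrow> numer_ac R - Polynomial.smult v (denom_ac R)
             | Infty \<Rightarrow> denom_ac R)"

definition ram_index :: "'a::field poly fract \<Rightarrow> 'a alg_closure proj_line \<Rightarrow> nat" where
  "ram_index R P =
    (let F = fibre_poly R (rat_map R P)
     in case P of Fin a \<Rightarrow> Polynomial.order a F
                | Infty \<Rightarrow> rat_degree R - Polynomial.degree F)"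

definition ram_indices :: "'a::field poly fract \<Rightarrow> nat multiset" where
  "ram_indices R = image_mset (ram_index R) (mset_set {P. ram_index R P > 1})"

section \<open>The list of representatives\<close>

definition abs_trace :: "'a::{finite,field} \<Rightarrow> 'a" where
  "abs_trace \<sigma> = (\<Sum>i | 2 ^ i \<le> CARD('a) div 2. \<sigma> ^ (2 ^ i))"

text \<open>
  The representatives are indexed by labels carrying the parameter, so that uniqueness of the label
  includes uniqueness of the parameters \<open>c\<close> and \<open>b\<close>.
\<close>

datatype 'a label =
    Form_i | Form_ii | Form_iii | Form_iv | Form_iv_theta | Form_iv_theta2
  | Form_v 'a | Form_vi 'a

fun admissible :: "'a::{finite,field} label \<Rightarrow> bool" where
  "admissible Form_i \<longleftrightarrow> True"
| "admissible Form_ii \<longleftrightarrow> True"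
| "admissible Form_iii \<longleftrightarrow> True"
| "admissible Form_iv \<longleftrightarrow> True"
| "admissible Form_iv_theta \<longleftrightarrow> (\<exists>m. CARD('a) = m ^ 2)"
| "admissible Form_iv_theta2 \<longleftrightarrow> (\<exists>m. CARD('a) = m ^ 2)"
| "admissible (Form_v c) \<longleftrightarrow> c \<notin> {0, 1}"
| "admissible (Form_vi b) \<longleftrightarrow> b \<notin> {0, 1}"

fun representative :: "'a::field \<Rightarrow> 'a \<Rightarrow> 'a label \<Rightarrow> 'a poly fract" where
  "representative \<sigma> \<theta> Form_i = Fract [:0, 0, 0, 1:] 1"
| "representative \<sigma> \<theta> Form_ii = Fract [:\<sigma>, \<sigma>, 0, 1:] [:\<sigma> + 1, 1, 1:]"
| "representative \<sigma> \<theta> Form_iii = Fract [:0, 0, 1, 1:] 1"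
| "representative \<sigma> \<theta> Form_iv = Fract [:1, 0, 0, 1:] [:0, 1:]"
| "representative \<sigma> \<theta> Form_iv_theta = Fract [:\<theta>, 0, 0, 1:] [:0, 1:]"
| "representative \<sigma> \<theta> Form_iv_theta2 = Fract [:\<theta> ^ 2, 0, 0, 1:] [:0, 1:]"
| "representative \<sigma> \<theta> (Form_v c) = Fract [:c, 0, 0, 1:] [:c, 1:]"
| "representative \<sigma> \<theta> (Form_vi b) = Fract [:(b + 1) * \<sigma>, \<sigma>, b, 1:] [:b + 1 + \<sigma>, 1, 1:]"

fun listed_indices :: "'a label \<Rightarrow> nat multiset" where
  "listed_indices Form_i = {#3, 3#}"
| "listed_indices Form_ii = {#3, 3#}"
| "listed_indices Form_iii = {#3, 2#}"
| "listed_indices Form_iv = {#2#}"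
| "listed_indices Form_iv_theta = {#2#}"
| "listed_indices Form_iv_theta2 = {#2#}"
| "listed_indices (Form_v c) = {#2, 2#}"
| "listed_indices (Form_vi b) = {#2, 2#}"

end

theory Submission
  imports Defs
begin

text \<open>
  Up to equivalence a cubic \<open>g/h\<close> is the pencil spanned by the binary cubic forms \<open>g\<close> and \<open>h\<close>,
  modulo linear substitutions. In characteristic two the Wronskian \<open>g' h - g h'\<close> has the shape
  \<open>w\<^sub>4 x\<^sup>4 + w\<^sub>2 x\<^sup>2 + w\<^sub>0\<close>, so it is the square of a quadratic form \<open>V\<close>. A double root of \<open>V\<close>
  (that is, \<open>w\<^sub>2 = 0\<close>) gives family (iv), two rational roots give (i), (iii), (v), and two conjugate roots,
  which can be moved to those of \<open>x\<^sup>2 + x + \<sigma>\<close> because \<open>y\<^sup>2 + y\<close> has an image of index two, give (ii)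
  and (vi). When \<open>w\<^sub>2 \<noteq> 0\<close>, the quotient of the resultant of \<open>g\<close> and \<open>h\<close> by \<open>w\<^sub>2\<^sup>3\<close> is an absolute
  invariant; it equals \<open>((c + 1)/c)\<^sup>2\<close> for (v), \<open>(b + 1)\<^sup>4\<close> for (vi), and \<open>1\<close> for (i), (ii), (iii),
  which separates the parameters.
\<close>

section \<open>Pencils of binary cubic forms\<close>

text \<open>The quotient is invariant because the resultant has weight
  \<open>(det N)^3 (det M)^9\<close> and \<open>w2\<close> has weight
  \<open>det N (det M)^3\<close>. That \<open>w2\<close> alone transforms by a scalar is special to
  characteristic two, where a substitution merely rescales the middle coefficient of a quadratic
  form. Injectivity of the quotient in \<open>c\<close> and in \<open>b\<close> comes down to
  injectivity of squaring. What the quotient cannot see is settled otherwise: split against nonsplit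
  by rationality of the roots of V; (i) against (iii), and the members of (iv) among each other, by
  determining which substitutions respect the roots of V. The excluded parameters are degenerate:
  \<open>c = 0\<close>, \<open>c = 1\<close> and \<open>b = 1\<close> give forms with a common
  factor, and \<open>b = 0\<close> gives (ii). The obstacle in the existence part is the conjugate
  pair of roots: once it has been placed, triangular substitutions no longer suffice, and a suitable
  element has to be found in a nonsplit torus. Finiteness enters through square roots, the image of
  \<open>y^2 + y\<close> and the classes modulo cubes.\<close>

text \<open>
  A quadruple is either a binary cubic form, with the coefficient of \<open>x\<^sup>i\<close> at position \<open>i\<close>, or a matrix,
  where \<open>(a, b, c, d)\<close> stands for the substitution \<open>x \<mapsto> (a x + b) / (c x + d)\<close>.
\<close>

type_synonym 'a quad = "'a \<times> 'a \<times> 'a \<times> 'a"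

text \<open>These are the coefficients of \<open>(c x + d)^3 g((a x + b) / (c x + d))\<close>.
  Homogenising in degree 3 keeps the action polynomial in the entries, whatever the actual degree of
  \<open>g\<close>.\<close>

fun cubic_subst :: "'a::comm_ring_1 quad \<Rightarrow> 'a quad \<Rightarrow> 'a quad" where
  "cubic_subst (a, b, c, d) (g0, g1, g2, g3) =
    (d^3*g0 + b*d^2*g1 + b^2*d*g2 + b^3*g3,
     3*c*d^2*g0 + (a*d^2 + 2*b*c*d)*g1 + (2*a*b*d + b^2*c)*g2 + 3*a*b^2*g3,
     3*c^2*d*g0 + (2*a*c*d + b*c^2)*g1 + (a^2*d + 2*a*b*c)*g2 + 3*a^2*b*g3,
     c^3*g0 + a*c^2*g1 + a^2*c*g2 + a^3*g3)"

fun lin_comb :: "'a::comm_ring_1 \<Rightarrow> 'a \<Rightarrow> 'a quad \<Rightarrow> 'a quad \<Rightarrow> 'a quad" where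
  "lin_comb e f (g0, g1, g2, g3) (h0, h1, h2, h3) =
    (e*g0 + f*h0, e*g1 + f*h1, e*g2 + f*h2, e*g3 + f*h3)"

fun mat_mul :: "'a::comm_ring_1 quad \<Rightarrow> 'a quad \<Rightarrow> 'a quad" where
  "mat_mul (a, b, c, d) (a', b', c', d') = (a*a' + b*c', a*b' + b*d', c*a' + d*c', c*b' + d*d')"

fun mat_det :: "'a::comm_ring_1 quad \<Rightarrow> 'a" where
  "mat_det (a, b, c, d) = a*d - b*c"

fun mat_adj :: "'a::comm_ring_1 quad \<Rightarrow> 'a quad" where
  "mat_adj (a, b, c, d) = (d, -b, -c, a)"

fun row_op :: "'a::comm_ring_1 quad \<Rightarrow> 'a quad \<times> 'a quad \<Rightarrow> 'a quad \<times> 'a quad" where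
  "row_op (e, f, k, l) (g, h) = (lin_comb e f g h, lin_comb k l g h)"

definition subst_pair :: "'a::comm_ring_1 quad \<Rightarrow> 'a quad \<times> 'a quad \<Rightarrow> 'a quad \<times> 'a quad" where
  "subst_pair M P = (cubic_subst M (fst P), cubic_subst M (snd P))"

definition pencil_equiv :: "'a::field quad \<times> 'a quad \<Rightarrow> 'a quad \<times> 'a quad \<Rightarrow> bool" where
  "pencil_equiv P Q \<longleftrightarrow>
    (\<exists>N M. mat_det N \<noteq> 0 \<and> mat_det M \<noteq> 0 \<and> Q = row_op N (subst_pair M P))"

lemma mat_det_mul: "mat_det (mat_mul A B) = mat_det A * mat_det B"
  by (cases A; cases B) (simp add: algebra_simps)

lemma mat_det_adj: "mat_det (mat_adj A) = mat_det A"
  by (cases A) (simp add: algebra_simps)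

text \<open>Substitution acts from the right, hence the reversed order of the matrices.\<close>

lemma cubic_subst_subst: "cubic_subst M (cubic_subst N g) = cubic_subst (mat_mul N M) g"
  by (cases M; cases N; cases g) (simp add: algebra_simps power2_eq_square power3_eq_cube)

lemma cubic_subst_lin_comb:
  "cubic_subst M (lin_comb e f g h) = lin_comb e f (cubic_subst M g) (cubic_subst M h)"
  by (cases M; cases g; cases h) (simp add: algebra_simps)

lemma cubic_subst_one: "cubic_subst (1, 0, 0, 1) g = g"
  by (cases g) simp

text \<open>A matrix times its adjugate is the scalar matrix of the determinant, which acts on cubic
  forms by its cube. Multiplication by \<open>e\<close> is written
  \<open>lin_comb e 0 g g\<close>.\<close>

lemma cubic_subst_adj:
  "cubic_subst (mat_adj M) (cubic_subst M g) = lin_comb (mat_det M ^ 3) 0 g g"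
  unfolding cubic_subst_subst
  by (cases M; cases g) (simp add: algebra_simps power2_eq_square power3_eq_cube)

lemma subst_pair_subst: "subst_pair M (subst_pair N P) = subst_pair (mat_mul N M) P"
  by (simp add: subst_pair_def cubic_subst_subst)

lemma subst_pair_row_op: "subst_pair M (row_op N P) = row_op N (subst_pair M P)"
  by (cases N; cases P) (simp add: subst_pair_def cubic_subst_lin_comb)

lemma row_op_row_op: "row_op M (row_op N P) = row_op (mat_mul M N) P"
proof -
  obtain g h where P: "P = (g, h)" by (cases P)
  show ?thesis unfolding P
    by (cases M; cases N; cases g; cases h) (simp add: algebra_simps)
qed

lemma row_op_one: "row_op (1, 0, 0, 1) P = P"
proof -
  obtain g h where P: "P = (g, h)" by (cases P)
  show ?thesis unfolding P by (cases g; cases h) simp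
qed

lemma subst_pair_one: "subst_pair (1, 0, 0, 1) P = P"
  by (simp add: subst_pair_def cubic_subst_one)

lemma pencil_equiv_row_op: "mat_det N \<noteq> 0 \<Longrightarrow> pencil_equiv P (row_op N P)"
  unfolding pencil_equiv_def
  by (rule exI[of _ N], rule exI[of _ "(1, 0, 0, 1)"]) (simp add: subst_pair_one)

lemma pencil_equiv_subst: "mat_det M \<noteq> 0 \<Longrightarrow> pencil_equiv P (subst_pair M P)"
  unfolding pencil_equiv_def
  by (rule exI[of _ "(1, 0, 0, 1)"], rule exI[of _ M]) (simp add: row_op_one)

lemma pencil_equiv_trans [trans]:
  assumes "pencil_equiv P Q" "pencil_equiv Q R"
  shows "pencil_equiv P R"
proof -
  obtain N M N' M' where
    "mat_det N \<noteq> 0" "mat_det M \<noteq> 0" "Q = row_op N (subst_pair M P)"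
    "mat_det N' \<noteq> 0" "mat_det M' \<noteq> 0" "R = row_op N' (subst_pair M' Q)"
    using assms unfolding pencil_equiv_def by blast
  then show ?thesis
    unfolding pencil_equiv_def
    by (intro exI[of _ "mat_mul N' N"] exI[of _ "mat_mul M M'"])
      (simp add: mat_det_mul subst_pair_row_op subst_pair_subst row_op_row_op)
qed

lemma row_op_adj:
  assumes "mat_det N \<noteq> (0::'a::field)"
  obtains N' where "mat_det N' \<noteq> 0" "\<And>P. row_op N' (row_op N P) = P"
proof -
  obtain e f k l where N: "N = (e, f, k, l)" by (cases N)
  define D where "D = e*l - f*k"
  have D: "D \<noteq> 0" using assms by (simp add: N D_def)
  have 1: "l/D*e + (-f/D)*k = 1" "l/D*f + (-f/D)*l = 0" "(-k/D)*e + e/D*k = 0" "(-k/D)*f + e/D*l = 1"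
    using D by (simp_all add: D_def divide_simps)
  have mm: "mat_mul (l/D, -f/D, -k/D, e/D) N = (1, 0, 0, 1)"
    unfolding N mat_mul.simps 1 ..
  have "mat_det (l/D, -f/D, -k/D, e/D) \<noteq> 0"
    using arg_cong[OF mm, of mat_det] by (auto simp: mat_det_mul simp del: mat_det.simps) (simp add: N)
  moreover have "row_op (l/D, -f/D, -k/D, e/D) (row_op N P) = P" for P
    unfolding row_op_row_op mm by (rule row_op_one)
  ultimately show thesis by (rule that)
qed

lemma row_op_scalar: "c \<noteq> (0::'a::field) \<Longrightarrow> row_op (1/c, 0, 0, 1/c) (lin_comb c 0 g g, lin_comb c 0 h h) = (g, h)"
  by (cases g; cases h) simp

lemma pencil_equiv_sym:
  assumes "pencil_equiv P (Q :: 'a::field quad \<times> 'a quad)"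
  shows "pencil_equiv Q P"
proof -
  obtain N M where NM: "mat_det N \<noteq> 0" "mat_det M \<noteq> 0" "Q = row_op N (subst_pair M P)"
    using assms unfolding pencil_equiv_def by blast
  obtain N' where N': "mat_det N' \<noteq> 0" "\<And>P. row_op N' (row_op N P) = P"
    using row_op_adj[OF NM(1)] by blast
  have "pencil_equiv Q (subst_pair M P)"
    using pencil_equiv_row_op[OF N'(1), of Q] NM(3) N'(2) by simp
  also have "pencil_equiv \<dots> (subst_pair (mat_adj M) (subst_pair M P))"
    by (rule pencil_equiv_subst) (simp add: mat_det_adj NM(2))
  also have "pencil_equiv \<dots> P"
  proof -
    \<comment> \<open>The adjugate undoes \<open>M\<close> only up to this factor, which a scalar
      row operation removes.\<close>
    define c where "c = mat_det M ^ 3"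
    have c: "c \<noteq> 0" using NM(2) by (simp add: c_def)
    have "pencil_equiv (subst_pair (mat_adj M) (subst_pair M P))
       (row_op (1/c, 0, 0, 1/c) (subst_pair (mat_adj M) (subst_pair M P)))"
      by (rule pencil_equiv_row_op) (simp add: c)
    then show ?thesis
      using row_op_scalar[OF c, of "fst P" "snd P"]
      by (simp add: subst_pair_def cubic_subst_adj c_def)
  qed
  finally show ?thesis .
qed

section \<open>Rational expressions and pencils\<close>

text \<open>A nonzero element of least degree in the ideal generated by \<open>p\<close> and
  \<open>q\<close> divides every element of the ideal, since remainders stay inside it; so it is a
  common divisor and therefore a unit.\<close>

lemma coprime_poly_bezout:
  fixes p q :: "'a::field poly"
  assumes "coprime p q"
  obtains u v where "u * p + v * q = 1"
proof -
  define I where "I = {u * p + v * q | u v. True}"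
  have I_diff: "x - c * y \<in> I" if "x \<in> I" "y \<in> I" for x y c
  proof -
    from that obtain u v u' v' where "x = u * p + v * q" "y = u' * p + v' * q"
      unfolding I_def by blast
    then have "x - c * y = (u - c * u') * p + (v - c * v') * q"
      by (simp add: algebra_simps)
    then show ?thesis unfolding I_def by blast
  qed
  have "1 * p + 0 * q \<in> I" "0 * p + 1 * q \<in> I"
    unfolding I_def by blast+
  then have pq: "p \<in> I" "q \<in> I" by simp_all
  have "\<not> (p = 0 \<and> q = 0)" using assms by auto
  then have ex: "\<exists>d. d \<in> I \<and> d \<noteq> 0" using pq by auto
  define d where "d = (ARG_MIN Polynomial.degree d. d \<in> I \<and> d \<noteq> 0)"
  have d: "d \<in> I" "d \<noteq> 0"
    using arg_min_natI[of "\<lambda>d. d \<in> I \<and> d \<noteq> 0", where m = Polynomial.degree] ex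
    unfolding d_def by blast+
  have min: "Polynomial.degree d \<le> Polynomial.degree r" if "r \<in> I" "r \<noteq> 0" for r
    unfolding d_def
    by (rule arg_min_nat_le[of "\<lambda>d. d \<in> I \<and> d \<noteq> 0", where m = Polynomial.degree]) (use that in blast)
  have "d dvd r" if "r \<in> I" for r
  proof (rule ccontr)
    assume nd: "\<not> d dvd r"
    have "r mod d = r - (r div d) * d" by (simp add: minus_div_mult_eq_mod)
    then have "r mod d \<in> I" using I_diff[OF that d(1)] by simp
    moreover have "r mod d \<noteq> 0" using nd by (simp add: dvd_eq_mod_eq_0)
    moreover have "Polynomial.degree (r mod d) < Polynomial.degree d"
      using degree_mod_less[OF d(2), of r] calculation by blast
    ultimately show False using min by force
  qed
  then have "d dvd 1" using assms pq by (meson coprime_common_divisor)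
  then obtain c where "1 = d * c" by (rule dvdE)
  moreover obtain u v where "d = u * p + v * q" using d(1) unfolding I_def by blast
  ultimately have "(c * u) * p + (c * v) * q = 1" by (simp add: algebra_simps)
  then show thesis by (rule that)
qed

lemma coprime_poly_dvd_mult:
  fixes p q r :: "'a::field poly"
  assumes "coprime p q" "p dvd q * r"
  shows "p dvd r"
proof -
  obtain u v where uv: "u * p + v * q = 1"
    using coprime_poly_bezout[OF assms(1)] .
  have "r = u * p * r + v * (q * r)"
    using arg_cong[OF uv, of "\<lambda>t. t * r"] by (simp add: algebra_simps)
  then show ?thesis using assms(2) by (metis dvd_add dvd_mult dvd_mult2 dvd_triv_right)
qed

text \<open>A representation whose denominator has least degree is reduced, because cancelling a
  nonconstant common factor would lower that degree.\<close>

lemma lowest_terms_exists: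
  fixes R :: "'a::field poly fract"
  obtains g h where "h \<noteq> 0" "coprime g h" "R = Fract g h"
proof -
  let ?Q = "\<lambda>(g, h). h \<noteq> 0 \<and> R = Fract g h"
  obtain g0 h0 where "R = Fract g0 h0" "h0 \<noteq> 0" by (cases R)
  then have ex: "?Q (g0, h0)" by simp
  define z where "z = arg_min (\<lambda>x. Polynomial.degree (snd x)) ?Q"
  have z: "?Q z" unfolding z_def by (rule arg_min_natI) (rule ex)
  have min: "Polynomial.degree (snd z) \<le> Polynomial.degree (snd y)" if "?Q y" for y
    unfolding z_def by (rule arg_min_nat_le) (rule that)
  obtain g h where zz: "z = (g, h)" by (cases z)
  have gh: "h \<noteq> 0" "R = Fract g h" using z zz by auto
  have "coprime g h"
  proof (rule coprimeI)
    fix k assume k: "k dvd g" "k dvd h"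
    then obtain g' h' where g': "g = k * g'" "h = k * h'" by (elim dvdE)
    have nz: "k \<noteq> 0" "h' \<noteq> 0" using gh g' by auto
    have "Fract g h = Fract g' h'" using nz by (simp add: g' eq_fract)
    then have "?Q (g', h')" using nz gh by simp
    from min[OF this] have "Polynomial.degree h \<le> Polynomial.degree h'" by (simp add: zz)
    also have "Polynomial.degree h = Polynomial.degree k + Polynomial.degree h'"
      using nz by (simp add: g' degree_mult_eq)
    finally have "Polynomial.degree k = 0" by simp
    then show "is_unit k" using nz by (simp add: is_unit_iff_degree)
  qed
  with gh show thesis by (intro that)
qed

lemma lowest_terms_spec:
  "denom R \<noteq> 0 \<and> coprime (numer R) (denom R) \<and> R = Fract (numer R) (denom R)"
proof -
  let ?Q = "\<lambda>(g, h). h \<noteq> 0 \<and> coprime g h \<and> R = Fract g h"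
  obtain g h where "h \<noteq> 0" "coprime g h" "R = Fract g h" by (rule lowest_terms_exists)
  then have "?Q (g, h)" by simp
  then have "?Q (lowest_terms R)" unfolding lowest_terms_def by (rule someI[of ?Q])
  then show ?thesis by (simp add: numer_def denom_def case_prod_unfold)
qed

lemma reduced_fraction_unique:
  fixes g h g' h' :: "'a::field poly"
  assumes "h \<noteq> 0" "coprime g h" "h' \<noteq> 0" "coprime g' h'" "Fract g h = Fract g' h'"
  obtains c where "c \<noteq> 0" "g' = Polynomial.smult c g" "h' = Polynomial.smult c h"
proof -
  have eq: "g * h' = g' * h" using assms by (simp add: eq_fract)
  have "h dvd g * h'" using eq by simp
  then have "h dvd h'" using coprime_poly_dvd_mult[of h g h'] assms(2) by (simp add: coprime_commute)
  then obtain k where k: "h' = h * k" by (rule dvdE)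
  have g': "g' = g * k" using eq assms(1) by (simp add: k)
  have "is_unit k" using assms(4) by (simp add: k g' coprime_common_divisor[of "g * k" "h * k"])
  then obtain c where c: "k = [:c:]" "c dvd 1" by (auto simp: is_unit_poly_iff)
  then have "c \<noteq> 0" by auto
  show thesis by (rule that[of c]) (use c \<open>c \<noteq> 0\<close> in \<open>simp_all add: k g'\<close>)
qed

lemma numer_denom_Fract:
  fixes g h :: "'a::field poly"
  assumes "h \<noteq> 0" "coprime g h"
  obtains c where "c \<noteq> 0" "numer (Fract g h) = Polynomial.smult c g"
    "denom (Fract g h) = Polynomial.smult c h"
  using reduced_fraction_unique[OF assms] lowest_terms_spec[of "Fract g h"] by metis

lemma rat_degree_Fract:
  fixes g h :: "'a::field poly"
  assumes "h \<noteq> 0" "coprime g h"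
  shows "rat_degree (Fract g h) = max (Polynomial.degree g) (Polynomial.degree h)"
  using numer_denom_Fract[OF assms] by (metis degree_smult_eq rat_degree_def)

lemma poly_at_rat_0 [simp]: "poly_at_rat 0 S = 0"
  by (simp add: poly_at_rat_def)

lemma poly_at_rat_pCons [simp]:
  "poly_at_rat (pCons a p) S = to_fract [:a:] + S * poly_at_rat p S"
  by (simp add: poly_at_rat_def map_poly_pCons to_fract_def Zero_fract_def)

lemma poly_at_rat_smult: "poly_at_rat (Polynomial.smult c p) S = to_fract [:c:] * poly_at_rat p S"
proof (induction p)
  case (pCons a p)
  have "to_fract [:c * a:] = to_fract [:c:] * to_fract [:a:]"
    by (subst to_fract_mult[symmetric]) simp
  with pCons show ?case by (simp add: algebra_simps)
qed simp

lemma rat_comp_Fract: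
  assumes "h \<noteq> 0" "coprime g h"
  shows "rat_comp (Fract g h) S = poly_at_rat g S / poly_at_rat h S"
proof -
  obtain c where "c \<noteq> 0" "numer (Fract g h) = Polynomial.smult c g"
    "denom (Fract g h) = Polynomial.smult c h"
    by (rule numer_denom_Fract[OF assms])
  then show ?thesis by (simp add: rat_comp_def poly_at_rat_smult)
qed

section \<open>Moebius transformations and the group of degree-one expressions\<close>

fun mobius :: "'a::field quad \<Rightarrow> 'a poly fract" where
  "mobius (a, b, c, d) = Fract [:b, a:] [:d, c:]"

lemma linear_coprime:
  fixes a b c d :: "'a::field"
  assumes "a * d - b * c \<noteq> 0"
  shows "[:d, c:] \<noteq> 0" "coprime [:b, a:] [:d, c:]"
proof -
  show "[:d, c:] \<noteq> 0" using assms by auto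
  show "coprime [:b, a:] [:d, c:]"
  proof (rule coprimeI)
    fix k assume k: "k dvd [:b, a:]" "k dvd [:d, c:]"
    have "k dvd Polynomial.smult a [:d, c:] - Polynomial.smult c [:b, a:]"
      by (intro dvd_diff dvd_smult k)
    also have "\<dots> = [:a * d - b * c:]" by (simp add: algebra_simps)
    finally show "is_unit k"
      using assms by (meson dvd_trans is_unit_const_poly_iff dvd_field_iff)
  qed
qed

lemma mobius_carrier:
  assumes "mat_det M \<noteq> 0"
  shows "mobius M \<in> carrier PGL2"
proof -
  obtain a b c d where M: "M = (a, b, c, d)" by (cases M)
  have "a * d - b * c \<noteq> 0" using assms M by simp
  then show ?thesis
    using linear_coprime[of a d b c] by (auto simp: M PGL2_def rat_degree_Fract)
qed

lemma degree_1_pCons: "Polynomial.degree p \<le> 1 \<Longrightarrow> p = [:Polynomial.coeff p 0, Polynomial.coeff p 1:]"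
  by (rule poly_eqI) (auto simp: coeff_pCons coeff_eq_0 split: nat.split)

lemma carrier_PGL2E:
  assumes "A \<in> carrier PGL2"
  obtains M where "mat_det M \<noteq> 0" "A = mobius M"
proof -
  define g h where "g = numer A" and "h = denom A"
  have A: "h \<noteq> 0" "coprime g h" "A = Fract g h" "max (Polynomial.degree g) (Polynomial.degree h) = 1"
    using assms lowest_terms_spec[of A] by (auto simp: PGL2_def rat_degree_def g_def h_def)
  obtain a b c d where gh: "g = [:b, a:]" "h = [:d, c:]"
    using degree_1_pCons[of g] degree_1_pCons[of h] A(4) by (metis max.cobounded1 max.cobounded2)
  have "a * d - b * c \<noteq> 0"
  proof
    assume "a * d - b * c = 0"
    then have ad: "a * d = b * c" by simp
    \<comment> \<open>By coprimality \<open>h\<close> divides the constants \<open>c\<close> and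
      \<open>d\<close>, and \<open>g\<close> divides \<open>a\<close> and \<open>b\<close>; so both
      have degree 0 although the larger degree is 1.\<close>
    have eq: "g * [:c:] = h * [:a:]" "g * [:d:] = h * [:b:]"
      using ad by (simp_all add: gh mult.commute)
    have dv: "h dvd [:c:]" "h dvd [:d:]" "g dvd [:a:]" "g dvd [:b:]"
      using coprime_poly_dvd_mult[of h g] coprime_poly_dvd_mult[of g h] A(2) eq
      by (metis coprime_commute dvd_triv_left)+
    have "Polynomial.degree h = 0" using dvd_imp_degree_le[OF dv(1)] dvd_imp_degree_le[OF dv(2)] A(1)
      by (cases "c = 0") (auto simp: gh)
    moreover have "Polynomial.degree g = 0"
      using dvd_imp_degree_le[OF dv(3)] by (cases "a = 0") (auto simp: gh)
    ultimately show False using A(4) by simp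
  qed
  then show thesis by (intro that[of "(a, b, c, d)"]) (simp_all add: A(3) gh)
qed

lemma rat_comp_mobius:
  fixes M :: "'a::field quad"
  assumes "mat_det M \<noteq> 0"
  obtains a b c d where "M = (a, b, c, d)"
    "\<And>S. rat_comp (mobius M) S = (to_fract [:b:] + S * to_fract [:a:]) / (to_fract [:d:] + S * to_fract [:c:])"
proof -
  obtain a b c d where M: "M = (a, b, c, d)" by (cases M)
  have "a * d - b * c \<noteq> 0" using assms M by simp
  then show thesis
    using linear_coprime[of a d b c] by (intro that[OF M]) (simp add: M rat_comp_Fract)
qed

lemma Fract_linear_fractional:
  fixes G H :: "'a::field poly"
  assumes "H \<noteq> 0"
  shows "(to_fract [:f:] + Fract G H * to_fract [:e:]) / (to_fract [:l:] + Fract G H * to_fract [:k:]) =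
    Fract (Polynomial.smult e G + Polynomial.smult f H) (Polynomial.smult k G + Polynomial.smult l H)"
proof -
  have H: "to_fract H \<noteq> 0" using assms by simp
  have eq: "to_fract [:y:] + Fract G H * to_fract [:x:] =
      to_fract (Polynomial.smult x G + Polynomial.smult y H) / to_fract H" for x y
  proof -
    have "Polynomial.smult x G + Polynomial.smult y H = [:x:] * G + [:y:] * H" by simp
    then show ?thesis using H by (simp only: to_fract_add to_fract_mult Fract_conv_to_fract) (simp add: field_simps)
  qed
  show ?thesis unfolding eq using H by (simp add: Fract_conv_to_fract)
qed

lemma rat_comp_mobius_mobius:
  fixes M N :: "'a::field quad"
  assumes "mat_det M \<noteq> 0" "mat_det N \<noteq> 0"
  shows "rat_comp (mobius M) (mobius N) = mobius (mat_mul M N)"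
proof -
  obtain a b c d where N: "N = (a, b, c, d)" by (cases N)
  obtain e f k l where M: "M = (e, f, k, l)"
    "\<And>S. rat_comp (mobius M) S = (to_fract [:f:] + S * to_fract [:e:]) / (to_fract [:l:] + S * to_fract [:k:])"
    using rat_comp_mobius[OF assms(1)] by blast
  have "[:d, c:] \<noteq> 0" using assms(2) by (auto simp: N)
  then show ?thesis
    by (simp add: M(2) N Fract_linear_fractional) (simp add: M(1) algebra_simps)
qed

lemma mat_mul_assoc: "mat_mul (mat_mul A B) C = mat_mul A (mat_mul B C)"
  by (cases A; cases B; cases C) (simp add: algebra_simps)

lemma PGL2_simps [simp]: "A \<otimes>\<^bsub>PGL2\<^esub> B = rat_comp A B" "\<one>\<^bsub>PGL2\<^esub> = rat_X"
  by (simp_all add: PGL2_def)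

lemma mobius_one: "mobius (1, 0, 0, 1) = rat_X"
  by (simp add: rat_X_def one_pCons)

lemma mobius_scalar: "c \<noteq> 0 \<Longrightarrow> mobius (c, 0, 0, c) = rat_X"
  by (simp add: rat_X_def eq_fract)

text \<open>All group laws are inherited from matrices; the adjugate supplies the inverse because
  scalar matrices represent the identity expression.\<close>

lemma group_PGL2: "group (PGL2 :: 'a::field poly fract monoid)"
proof (rule groupI)
  fix A B C :: "'a poly fract"
  assume "A \<in> carrier PGL2" "B \<in> carrier PGL2" "C \<in> carrier PGL2"
  then obtain L M N where *: "mat_det L \<noteq> 0" "mat_det M \<noteq> 0" "mat_det N \<noteq> 0"
    "A = mobius L" "B = mobius M" "C = mobius N"
    by (metis carrier_PGL2E)
  show "A \<otimes>\<^bsub>PGL2\<^esub> B \<otimes>\<^bsub>PGL2\<^esub> C = A \<otimes>\<^bsub>PGL2\<^esub> (B \<otimes>\<^bsub>PGL2\<^esub> C)"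
    using * by (simp add: rat_comp_mobius_mobius mat_det_mul mat_mul_assoc)
next
  fix A B :: "'a poly fract"
  assume "A \<in> carrier PGL2" "B \<in> carrier PGL2"
  then obtain L M where "mat_det L \<noteq> 0" "mat_det M \<noteq> 0" "A = mobius L" "B = mobius M"
    by (metis carrier_PGL2E)
  then show "A \<otimes>\<^bsub>PGL2\<^esub> B \<in> carrier PGL2"
    by (simp add: rat_comp_mobius_mobius mat_det_mul mobius_carrier)
next
  have "mobius (1, 0, 0, 1) \<in> carrier (PGL2 :: 'a poly fract monoid)"
    by (rule mobius_carrier) simp
  then show "\<one>\<^bsub>PGL2\<^esub> \<in> carrier (PGL2 :: 'a poly fract monoid)" by (simp only: PGL2_simps mobius_one)
next
  fix A :: "'a poly fract"
  assume "A \<in> carrier PGL2"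
  then obtain M where M: "mat_det M \<noteq> 0" "A = mobius M" by (rule carrier_PGL2E)
  have "rat_comp (mobius (1, 0, 0, 1)) (mobius M) = mobius M"
    using M by (subst rat_comp_mobius_mobius) (cases M; simp)+
  then show "\<one>\<^bsub>PGL2\<^esub> \<otimes>\<^bsub>PGL2\<^esub> A = A" using M(2) by (simp only: PGL2_simps mobius_one)
  obtain a b c d where abcd: "M = (a, b, c, d)" by (cases M)
  have "mat_mul (mat_adj M) M = (mat_det M, 0, 0, mat_det M)"
    by (simp add: abcd algebra_simps)
  then have "rat_comp (mobius (mat_adj M)) A = rat_X"
    using M by (simp add: rat_comp_mobius_mobius mat_det_adj mobius_scalar del: mobius.simps)
  moreover have "mobius (mat_adj M) \<in> carrier PGL2"
    by (rule mobius_carrier) (simp add: mat_det_adj M)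
  ultimately show "\<exists>B\<in>carrier PGL2. B \<otimes>\<^bsub>PGL2\<^esub> A = \<one>\<^bsub>PGL2\<^esub>"
    by (intro bexI) simp_all
qed

lemma rat_equivalent_iff:
  fixes R S :: "'a::field poly fract"
  shows "rat_equivalent R S \<longleftrightarrow>
    (\<exists>N M. mat_det N \<noteq> 0 \<and> mat_det M \<noteq> 0 \<and> S = rat_comp (mobius N) (rat_comp R (mobius M)))"
    (is "_ \<longleftrightarrow> ?r")
proof
  interpret group "PGL2 :: 'a poly fract monoid" by (rule group_PGL2)
  {
    assume "rat_equivalent R S"
    then obtain B A where "B \<in> carrier PGL2" "A \<in> carrier PGL2" "S = rat_comp B (rat_comp R (inv\<^bsub>PGL2\<^esub> A))"
      by (auto simp: rat_equivalent_def orbit_def rat_action_def DirProd_def)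
    then show ?r by (metis carrier_PGL2E inv_closed)
  }
  assume ?r
  then obtain N M where *: "mat_det N \<noteq> 0" "mat_det M \<noteq> 0" "S = rat_comp (mobius N) (rat_comp R (mobius M))"
    by blast
  have c: "mobius N \<in> carrier PGL2" "mobius M \<in> carrier PGL2"
    using * mobius_carrier by blast+
  show "rat_equivalent R S"
    unfolding rat_equivalent_def orbit_def
    \<comment> \<open>The action inverts its second component, so the witness is the inverse of the
      wanted substitution.\<close>
    by (rule CollectI, rule exI[of _ "(mobius N, inv\<^bsub>PGL2\<^esub> (mobius M))"])
      (use * c in \<open>simp add: rat_action_def DirProd_def\<close>)
qed

section \<open>Cubic expressions as quotients of binary cubic forms\<close>

fun cubic_poly :: "'a::zero quad \<Rightarrow> 'a poly" where
  "cubic_poly (g0, g1, g2, g3) = [:g0, g1, g2, g3:]"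

definition pencil_fract :: "'a::field quad \<times> 'a quad \<Rightarrow> 'a poly fract" where
  "pencil_fract P = Fract (cubic_poly (fst P)) (cubic_poly (snd P))"

definition reduced_cubic :: "'a::field quad \<times> 'a quad \<Rightarrow> bool" where
  "reduced_cubic P \<longleftrightarrow> cubic_poly (snd P) \<noteq> 0 \<and> coprime (cubic_poly (fst P)) (cubic_poly (snd P)) \<and>
    max (Polynomial.degree (cubic_poly (fst P))) (Polynomial.degree (cubic_poly (snd P))) = 3"

lemma cubic_poly_eq_iff [simp]: "cubic_poly g = cubic_poly h \<longleftrightarrow> g = h"
  by (cases g; cases h) simp

lemma cubic_poly_eq_0_iff: "cubic_poly g = 0 \<longleftrightarrow> g = (0, 0, 0, 0)"
  by (cases g) simp

lemma degree_cubic_poly: "Polynomial.degree (cubic_poly g) \<le> 3"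
  by (cases g) simp

lemma degree_le_3_cubic_poly:
  assumes "Polynomial.degree p \<le> 3"
  obtains g where "p = cubic_poly g"
proof
  show "p = cubic_poly (Polynomial.coeff p 0, Polynomial.coeff p 1, Polynomial.coeff p 2, Polynomial.coeff p 3)"
    using assms
    by (intro poly_eqI)
      (auto simp: coeff_pCons coeff_eq_0 numeral_2_eq_2 numeral_3_eq_3 split: nat.split)
qed

lemma cubic_poly_lin_comb:
  "cubic_poly (lin_comb e f g h) = Polynomial.smult e (cubic_poly g) + Polynomial.smult f (cubic_poly h)"
  by (cases g; cases h) simp

lemma degree_3_pencil:
  fixes R :: "'a::field poly fract"
  assumes "rat_degree R = 3"
  obtains P where "reduced_cubic P" "R = pencil_fract P"
proof -
  have d: "denom R \<noteq> 0" "coprime (numer R) (denom R)" "R = Fract (numer R) (denom R)"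
    using lowest_terms_spec[of R] by auto
  have deg: "max (Polynomial.degree (numer R)) (Polynomial.degree (denom R)) = 3"
    using assms by (simp add: rat_degree_def)
  obtain g where g: "numer R = cubic_poly g"
    using deg by (metis degree_le_3_cubic_poly max.cobounded1)
  obtain h where h: "denom R = cubic_poly h"
    using deg by (metis degree_le_3_cubic_poly max.cobounded2)
  show thesis
    by (rule that[of "(g, h)"]) (use d[unfolded g h] deg[unfolded g h] in \<open>auto simp: reduced_cubic_def pencil_fract_def\<close>)
qed

lemma cubic_poly_subst:
  "cubic_poly (cubic_subst (a, b, c, d) (g0, g1, g2, g3)) =
    [:g0:] * [:d, c:] ^ 3 + [:g1:] * [:b, a:] * [:d, c:] ^ 2 + [:g2:] * [:b, a:] ^ 2 * [:d, c:] + [:g3:] * [:b, a:] ^ 3"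
  by (simp add: power2_eq_square power3_eq_cube algebra_simps)

text \<open>The denominator is the same for every form \<open>g\<close>, even one of smaller degree,
  and so it cancels in the quotient of two forms.\<close>

lemma poly_at_rat_mobius:
  fixes M g :: "'a::field quad"
  assumes "M = (a, b, c, d)" "mat_det M \<noteq> 0"
  shows "poly_at_rat (cubic_poly g) (mobius M) = to_fract (cubic_poly (cubic_subst M g)) / to_fract ([:d, c:] ^ 3)"
proof -
  obtain g0 g1 g2 g3 where g: "g = (g0, g1, g2, g3)" by (cases g)
  have pw: "to_fract (p ^ n) = to_fract p ^ n" for p :: "'a poly" and n
    by (induction n) simp_all
  have clear_denom: "poly_at_rat (cubic_poly g) (to_fract u / to_fract v) =
      to_fract ([:g0:] * v ^ 3 + [:g1:] * u * v ^ 2 + [:g2:] * u ^ 2 * v + [:g3:] * u ^ 3) / to_fract (v ^ 3)"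
    if "v \<noteq> 0" for u v
  proof -
    have "to_fract v \<noteq> 0" using that by simp
    then show ?thesis
      unfolding g to_fract_add to_fract_mult pw
      by (simp add: field_simps power2_eq_square power3_eq_cube)
  qed
  have "[:d, c:] \<noteq> 0" using assms by auto
  from clear_denom[OF this, of "[:b, a:]"] show ?thesis
    unfolding g assms(1) cubic_poly_subst by (simp only: mobius.simps Fract_conv_to_fract)
qed

lemma cubic_poly_subst_nonzero:
  assumes "mat_det M \<noteq> (0::'a::field)" "cubic_poly g \<noteq> 0"
  shows "cubic_poly (cubic_subst M g) \<noteq> 0"
proof
  assume "cubic_poly (cubic_subst M g) = 0"
  then have "cubic_subst M g = (0, 0, 0, 0)" by (simp add: cubic_poly_eq_0_iff)
  then have "lin_comb (mat_det M ^ 3) 0 g g = (0, 0, 0, 0)"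
    using cubic_subst_adj[of M g] by (cases M) simp
  then show False using assms by (cases g) simp
qed

lemma rat_comp_pencil_fract:
  fixes P :: "'a::field quad \<times> 'a quad"
  assumes "reduced_cubic P" "mat_det N \<noteq> 0" "mat_det M \<noteq> 0"
  shows "rat_comp (mobius N) (rat_comp (pencil_fract P) (mobius M)) =
    pencil_fract (row_op N (subst_pair M P))"
proof -
  obtain a b c d where M: "M = (a, b, c, d)" by (cases M)
  obtain g h where P: "P = (g, h)" by (cases P)
  have gh: "cubic_poly h \<noteq> 0" "coprime (cubic_poly g) (cubic_poly h)"
    using assms(1) by (auto simp: reduced_cubic_def P)
  have nz: "[:d, c:] \<noteq> 0" using assms(3) by (auto simp: M)
  have "rat_comp (pencil_fract P) (mobius M) =
      poly_at_rat (cubic_poly g) (mobius M) / poly_at_rat (cubic_poly h) (mobius M)"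
    using gh by (simp add: pencil_fract_def P rat_comp_Fract)
  also have "\<dots> = Fract (cubic_poly (cubic_subst M g)) (cubic_poly (cubic_subst M h))"
    using nz by (simp add: poly_at_rat_mobius[OF M assms(3)] Fract_conv_to_fract)
  finally have comp: "rat_comp (pencil_fract P) (mobius M) = \<dots>" .
  obtain e f k l where N: "N = (e, f, k, l)"
    "\<And>S. rat_comp (mobius N) S = (to_fract [:f:] + S * to_fract [:e:]) / (to_fract [:l:] + S * to_fract [:k:])"
    using rat_comp_mobius[OF assms(2)] by blast
  show ?thesis
    unfolding comp N(2) Fract_linear_fractional[OF cubic_poly_subst_nonzero[OF assms(3) gh(1)]]
    by (simp add: pencil_fract_def N(1) P subst_pair_def cubic_poly_lin_comb)
qed

text \<open>\<open>P\<close> is not assumed reduced. It is a polynomial multiple of the reduced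
  \<open>Q\<close>, and as one form of \<open>Q\<close> already has degree 3, the degree bound on
  cubic forms makes the multiplier constant.\<close>

lemma pencil_fract_eqD:
  fixes P Q :: "'a::field quad \<times> 'a quad"
  assumes "reduced_cubic Q" "pencil_fract P = pencil_fract Q"
  obtains c where "c \<noteq> 0" "P = row_op (c, 0, 0, c) Q"
proof -
  obtain g h g' h' where P: "P = (g, h)" and Q: "Q = (g', h')" by (metis prod.collapse)
  have Q': "cubic_poly h' \<noteq> 0" "coprime (cubic_poly g') (cubic_poly h')"
    "max (Polynomial.degree (cubic_poly g')) (Polynomial.degree (cubic_poly h')) = 3"
    using assms(1) by (auto simp: reduced_cubic_def Q)
  \<comment> \<open>A zero denominator in \<open>P\<close> would give the default value 0. The
    expression of \<open>Q\<close> is not 0: a zero numerator would force its denominator to be a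
    unit, against degree 3.\<close>
  have "Fract (cubic_poly g') (cubic_poly h') \<noteq> 0"
    using Q' is_unit_iff_degree[OF Q'(1)] by (auto simp: Zero_fract_def eq_fract)
  then have h: "cubic_poly h \<noteq> 0"
    using assms(2) by (auto simp: pencil_fract_def P Q Fract_conv_to_fract)
  then have eq: "cubic_poly g * cubic_poly h' = cubic_poly g' * cubic_poly h"
    using assms(2) Q' by (simp add: pencil_fract_def P Q eq_fract)
  then have "cubic_poly h' dvd cubic_poly h"
    using coprime_poly_dvd_mult[of "cubic_poly h'" "cubic_poly g'" "cubic_poly h"] Q'(2)
    by (metis coprime_commute dvd_triv_right)
  then obtain k where k: "cubic_poly h = cubic_poly h' * k" by (rule dvdE)
  have k': "cubic_poly g = cubic_poly g' * k" using eq Q'(1) by (simp add: k)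
  have knz: "k \<noteq> 0" using h k by auto
  have "Polynomial.degree k = 0"
  proof (cases "Polynomial.degree (cubic_poly h') = 3")
    case True
    then show ?thesis using k knz Q'(1) degree_cubic_poly[of h] by (simp add: degree_mult_eq)
  next
    case False
    then have "Polynomial.degree (cubic_poly g') = 3" using Q'(3) by linarith
    moreover from this have "cubic_poly g' \<noteq> 0" by auto
    ultimately show ?thesis using k' knz degree_cubic_poly[of g] by (simp add: degree_mult_eq)
  qed
  then obtain c where c: "k = [:c:]" by (metis degree_0_id)
  have "cubic_poly h = cubic_poly (lin_comb c 0 h' h')" "cubic_poly g = cubic_poly (lin_comb c 0 g' g')"
    using k k' by (simp_all add: c cubic_poly_lin_comb)
  then have "h = lin_comb c 0 h' h'" "g = lin_comb c 0 g' g'" by (simp_all only: cubic_poly_eq_iff)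
  then have "P = row_op (c, 0, 0, c) Q"
    by (cases g'; cases h') (simp add: P Q)
  with knz c show thesis by (intro that[of c]) auto
qed

lemma rat_equivalent_pencil_fract:
  fixes P Q :: "'a::field quad \<times> 'a quad"
  assumes "reduced_cubic P" "reduced_cubic Q"
  shows "rat_equivalent (pencil_fract P) (pencil_fract Q) \<longleftrightarrow> pencil_equiv P Q"
proof
  assume "pencil_equiv P Q"
  then show "rat_equivalent (pencil_fract P) (pencil_fract Q)"
    unfolding pencil_equiv_def rat_equivalent_iff
    using rat_comp_pencil_fract[OF assms(1)] by metis
next
  assume "rat_equivalent (pencil_fract P) (pencil_fract Q)"
  then obtain N M where *: "mat_det N \<noteq> 0" "mat_det M \<noteq> 0"
    "pencil_fract (row_op N (subst_pair M P)) = pencil_fract Q"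
    unfolding rat_equivalent_iff using rat_comp_pencil_fract[OF assms(1)] by metis
  obtain c where c: "c \<noteq> 0" "row_op N (subst_pair M P) = row_op (c, 0, 0, c) Q"
    by (rule pencil_fract_eqD[OF assms(2) *(3)])
  have "pencil_equiv Q (row_op N (subst_pair M P))"
    unfolding c(2) by (rule pencil_equiv_row_op) (use c(1) in simp)
  moreover have "pencil_equiv P (row_op N (subst_pair M P))"
    unfolding pencil_equiv_def using * by blast
  ultimately show "pencil_equiv P Q" using pencil_equiv_sym pencil_equiv_trans by blast
qed

section \<open>Common factors of a pencil, including those at infinity\<close>

fun lin_quad_mult :: "'a::comm_ring_1 \<times> 'a \<Rightarrow> 'a \<times> 'a \<times> 'a \<Rightarrow> 'a quad" where
  "lin_quad_mult (t, s) (u0, u1, u2) = (t*u0, t*u1 + s*u0, t*u2 + s*u1, s*u2)"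

fun lin_subst :: "'a::comm_ring_1 quad \<Rightarrow> 'a \<times> 'a \<Rightarrow> 'a \<times> 'a" where
  "lin_subst (a, b, c, d) (t, s) = (b*s + d*t, a*s + c*t)"

fun quadratic_subst :: "'a::comm_ring_1 quad \<Rightarrow> 'a \<times> 'a \<times> 'a \<Rightarrow> 'a \<times> 'a \<times> 'a" where
  "quadratic_subst (a, b, c, d) (u0, u1, u2) =
    (b^2*u2 + b*d*u1 + d^2*u0, 2*a*b*u2 + (a*d + b*c)*u1 + 2*c*d*u0, a^2*u2 + a*c*u1 + c^2*u0)"

lemma cubic_subst_lin_quad_mult:
  "cubic_subst M (lin_quad_mult p u) = lin_quad_mult (lin_subst M p) (quadratic_subst M u)"
  by (cases M; cases p; cases u) (simp add: algebra_simps power2_eq_square power3_eq_cube)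

lemma cubic_poly_lin_quad_mult:
  "cubic_poly (lin_quad_mult (t, s) (u0, u1, u2)) = [:t, s:] * [:u0, u1, u2:]"
  by (simp add: algebra_simps)

lemma lin_comb_lin_quad_mult1:
  "\<exists>w. lin_comb e f (lin_quad_mult p u) (lin_quad_mult p v) = lin_quad_mult p w"
proof -
  obtain t s u0 u1 u2 v0 v1 v2 where *: "p = (t, s)" "u = (u0, u1, u2)" "v = (v0, v1, v2)"
    by (metis prod.collapse)
  show ?thesis
    by (rule exI[of _ "(e*u0 + f*v0, e*u1 + f*v1, e*u2 + f*v2)"]) (simp add: * algebra_simps)
qed

lemma lin_comb_lin_quad_mult2:
  "\<exists>q. lin_comb e f (lin_quad_mult p u) (lin_quad_mult p' u) = lin_quad_mult q u"
proof -
  obtain t s t' s' u0 u1 u2 where *: "p = (t, s)" "p' = (t', s')" "u = (u0, u1, u2)"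
    by (metis prod.collapse)
  show ?thesis
    by (rule exI[of _ "(e*t + f*t', e*s + f*s')"]) (simp add: * algebra_simps)
qed

text \<open>A common linear factor survives substitutions and row operations, so it can be carried
  back to \<open>P\<close>. There \<open>(t, s)\<close> means \<open>t + s x\<close>: for
  \<open>s = 0\<close> its root is at infinity and both degrees drop below 3, otherwise it
  contradicts coprimality.\<close>

lemma reduced_cubic_no_linear_factor:
  fixes P :: "'a::field quad \<times> 'a quad"
  assumes "reduced_cubic P" "pencil_equiv P (lin_quad_mult p u, lin_quad_mult p v)"
  shows False
proof -
  obtain N M where NM: "mat_det N \<noteq> 0" "mat_det M \<noteq> 0"
    "P = row_op N (subst_pair M (lin_quad_mult p u, lin_quad_mult p v))"
    using pencil_equiv_sym[OF assms(2)] unfolding pencil_equiv_def by blast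
  obtain e f k l where N: "N = (e, f, k, l)" by (cases N)
  obtain t s where q: "lin_subst M p = (t, s)" by (cases "lin_subst M p")
  have "\<exists>u' v'. P = (lin_quad_mult (t, s) u', lin_quad_mult (t, s) v')"
    unfolding NM(3) N subst_pair_def fst_conv snd_conv cubic_subst_lin_quad_mult q row_op.simps
    using lin_comb_lin_quad_mult1 by blast
  then obtain u0 u1 u2 v0 v1 v2 where
    P: "P = (lin_quad_mult (t, s) (u0, u1, u2), lin_quad_mult (t, s) (v0, v1, v2))"
    by (metis prod.collapse)
  show False
  proof (cases "s = 0")
    case True
    then have "Polynomial.degree (cubic_poly (fst P)) \<le> 2" "Polynomial.degree (cubic_poly (snd P)) \<le> 2"
      by (simp_all add: P)
    then show False using assms(1) by (auto simp: reduced_cubic_def max_def split: if_splits)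
  next
    case False
    have "[:t, s:] dvd cubic_poly (fst P)" "[:t, s:] dvd cubic_poly (snd P)"
      unfolding P fst_conv snd_conv cubic_poly_lin_quad_mult by (rule dvd_triv_left)+
    then have "is_unit [:t, s:]"
      using assms(1) coprime_common_divisor unfolding reduced_cubic_def by blast
    then show False using False by (simp add: is_unit_iff_degree)
  qed
qed

lemma reduced_cubic_no_quadratic_factor:
  fixes P :: "'a::field quad \<times> 'a quad"
  assumes "reduced_cubic P" "pencil_equiv P (lin_quad_mult p u, lin_quad_mult p' u)"
  shows False
proof -
  obtain N M where NM: "mat_det N \<noteq> 0" "mat_det M \<noteq> 0"
    "P = row_op N (subst_pair M (lin_quad_mult p u, lin_quad_mult p' u))"
    using pencil_equiv_sym[OF assms(2)] unfolding pencil_equiv_def by blast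
  obtain e f k l where N: "N = (e, f, k, l)" by (cases N)
  obtain u0 u1 u2 where u: "quadratic_subst M u = (u0, u1, u2)" by (metis prod.collapse)
  have "\<exists>q q'. P = (lin_quad_mult q (u0, u1, u2), lin_quad_mult q' (u0, u1, u2))"
    unfolding NM(3) N subst_pair_def fst_conv snd_conv cubic_subst_lin_quad_mult u row_op.simps
    using lin_comb_lin_quad_mult2 by blast
  then obtain t s t' s' where
    P: "P = (lin_quad_mult (t, s) (u0, u1, u2), lin_quad_mult (t', s') (u0, u1, u2))"
    by (metis prod.collapse)
  have *: "cubic_poly (fst P) = [:t, s:] * [:u0, u1, u2:]" "cubic_poly (snd P) = [:t', s':] * [:u0, u1, u2:]"
    unfolding P fst_conv snd_conv cubic_poly_lin_quad_mult by (rule refl)+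
  then have "is_unit [:u0, u1, u2:]"
    using assms(1) coprime_common_divisor unfolding reduced_cubic_def by (metis dvd_triv_right)
  \<comment> \<open>A common quadratic form that is constant as a polynomial has both roots at
    infinity, which leaves the cubics with degree at most 1.\<close>
  then have "Polynomial.degree [:u0, u1, u2:] = 0" using is_unit_iff_degree[of "[:u0, u1, u2:]"] by fastforce
  then have "Polynomial.degree (cubic_poly (fst P)) \<le> 1" "Polynomial.degree (cubic_poly (snd P)) \<le> 1"
    unfolding * using degree_mult_le[of "[:t, s:]" "[:u0, u1, u2:]"] degree_mult_le[of "[:t', s':]" "[:u0, u1, u2:]"]
    by (auto split: if_splits)
  then show False using assms(1) by (auto simp: reduced_cubic_def max_def split: if_splits)
qed

text \<open>All members of such a pencil are multiples of one form, which coprimality makes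
  constant, against degree 3.\<close>

lemma reduced_cubic_not_proportional:
  fixes P :: "'a::field quad \<times> 'a quad"
  assumes "reduced_cubic P" "pencil_equiv P (g, (0, 0, 0, 0))"
  shows False
proof -
  obtain N M where NM: "mat_det N \<noteq> 0" "mat_det M \<noteq> 0"
    "P = row_op N (subst_pair M (g, (0, 0, 0, 0)))"
    using pencil_equiv_sym[OF assms(2)] unfolding pencil_equiv_def by blast
  obtain e f k l where N: "N = (e, f, k, l)" by (cases N)
  have z: "cubic_subst M (0, 0, 0, 0) = (0, 0, 0, 0)" by (cases M) simp
  define G where "G = cubic_poly (cubic_subst M g)"
  have *: "cubic_poly (fst P) = Polynomial.smult e G" "cubic_poly (snd P) = Polynomial.smult k G"
    by (simp_all add: NM(3) N subst_pair_def z cubic_poly_lin_comb G_def)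
  then have "is_unit G"
    using assms(1) coprime_common_divisor unfolding reduced_cubic_def by (metis dvd_smult dvd_refl)
  then have "Polynomial.degree G = 0" using is_unit_iff_degree[of G] by fastforce
  then show False using assms(1) degree_smult_le[of e G] degree_smult_le[of k G]
    by (auto simp: reduced_cubic_def * max_def split: if_splits)
qed

section \<open>Covariants in characteristic two\<close>

text \<open>
  The next three definitions are meant for characteristic two, where signs disappear: the Pluecker
  coordinates \<open>p\<^sub>3\<^sub>2, p\<^sub>3\<^sub>1, p\<^sub>3\<^sub>0, p\<^sub>2\<^sub>1, p\<^sub>2\<^sub>0, p\<^sub>1\<^sub>0\<close>; the coefficients of \<open>x\<^sup>4\<close>, \<open>x\<^sup>2\<close>, \<open>1\<close> in
  \<open>g' h - g h'\<close>, whose odd coefficients vanish; and the determinant of the Bezout matrix.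
\<close>

fun minor :: "('a::comm_ring_1 quad \<times> 'a quad) \<Rightarrow> 'a \<times> 'a \<times> 'a \<times> 'a \<times> 'a \<times> 'a" where
  "minor ((g0, g1, g2, g3), (h0, h1, h2, h3)) =
    (g3*h2 + g2*h3, g3*h1 + g1*h3, g3*h0 + g0*h3, g2*h1 + g1*h2, g2*h0 + g0*h2, g1*h0 + g0*h1)"

fun wronsk :: "('a::comm_ring_1 quad \<times> 'a quad) \<Rightarrow> 'a \<times> 'a \<times> 'a" where
  "wronsk ((g0, g1, g2, g3), (h0, h1, h2, h3)) =
    (g3*h2 + g2*h3, g3*h0 + g0*h3 + g2*h1 + g1*h2, g1*h0 + g0*h1)"

definition resultant :: "('a::comm_ring_1 quad \<times> 'a quad) \<Rightarrow> 'a" where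
  "resultant P = (case minor P of (p32, p31, p30, p21, p20, p10) \<Rightarrow>
    (p30 + p21)*p10*p32 + p10*p31^2 + p20^2*p32 + p30^2*(p30 + p21))"

locale field_char_2 =
  fixes ty :: "'a::field itself"
  assumes CHAR_2: "CHAR('a) = 2"
begin

lemma two_eq_0 [simp]: "(2 :: 'a) = 0"
  using CHAR_2 of_nat_CHAR[where 'a = 'a] by simp

lemma three_eq_1 [simp]: "(3 :: 'a) = 1"
proof -
  have "(3 :: 'a) = 1 + 2" by (simp del: two_eq_0)
  also have "\<dots> = 1 + 0" by (rule arg_cong[OF two_eq_0])
  finally show ?thesis by (rule trans) (rule add_0_right)
qed

lemma add_self [simp]: "(x::'a) + x = 0"
  by (simp flip: mult_2)

lemma add_self_left [simp]: "(x::'a) + (x + y) = y"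
  by (simp flip: add.assoc)

lemma uminus_eq [simp]: "- (x::'a) = x"
  by (rule minus_unique) simp

lemma diff_eq [simp]: "(x::'a) - y = x + y"
  by (simp add: diff_conv_add_uminus del: add_uminus_conv_diff)

lemma add_eq_0_iff2: "(x::'a) + y = 0 \<longleftrightarrow> x = y"
  by (metis add_self add_self_left add_0_right)

text \<open>The Wronskian is a quartic covariant, so its outer coefficients become its values at the
  columns \<open>(a : c)\<close> and \<open>(b : d)\<close>. The middle coefficient of its square
  root V is just multiplied by the determinant, since the terms \<open>2ab\<close> and
  \<open>2cd\<close> vanish.\<close>

lemma wronsk_subst:
  fixes P :: "'a quad \<times> 'a quad"
  assumes "wronsk P = (w4, w2, w0)" "M = (a, b, c, d)"
  shows "wronsk (subst_pair M P) =
    (mat_det M * (w4*a^4 + w2*a^2*c^2 + w0*c^4), mat_det M ^ 3 * w2,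
     mat_det M * (w4*b^4 + w2*b^2*d^2 + w0*d^4))"
proof -
  obtain g h where P: "P = (g, h)" by (cases P)
  show ?thesis using assms
    apply (cases g; cases h)
    apply (clarsimp simp: P subst_pair_def)
    apply (simp add: algebra_simps power2_eq_square power3_eq_cube power4_eq_xxxx)
    done
qed

lemma wronsk_row_op:
  fixes P :: "'a quad \<times> 'a quad"
  assumes "wronsk P = (w4, w2, w0)"
  shows "wronsk (row_op N P) = (mat_det N * w4, mat_det N * w2, mat_det N * w0)"
proof -
  obtain g h where P: "P = (g, h)" by (cases P)
  show ?thesis using assms
    by (cases g; cases h; cases N) (clarsimp simp: P algebra_simps)
qed

text \<open>A row operation scales all minors by its determinant, and the resultant is cubic in the
  minors.\<close>

lemma resultant_row_op:
  fixes P :: "'a quad \<times> 'a quad"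
  shows "resultant (row_op N P) = mat_det N ^ 3 * resultant P"
proof -
  obtain g h where P: "P = (g, h)" by (cases P)
  obtain p32 p31 p30 p21 p20 p10 where p: "minor P = (p32, p31, p30, p21, p20, p10)"
    by (metis prod.collapse)
  define D where "D = mat_det N"
  have p': "minor (row_op N P) = (D*p32, D*p31, D*p30, D*p21, D*p20, D*p10)"
    using p by (cases g; cases h; cases N) (clarsimp simp: P D_def algebra_simps)
  show ?thesis unfolding resultant_def p p' D_def[symmetric]
    by (simp add: algebra_simps power2_eq_square power3_eq_cube)
qed

lemma resultant_swap:
  fixes P :: "'a quad \<times> 'a quad"
  shows "resultant (subst_pair (0, 1, 1, 0) P) = resultant P"
proof -
  obtain g h where P: "P = (g, h)" by (cases P)
  show ?thesis
    by (cases g; cases h)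
      (simp add: resultant_def P subst_pair_def algebra_simps power2_eq_square power3_eq_cube)
qed

lemma minor_triangular:
  fixes P :: "'a quad \<times> 'a quad"
  assumes "minor P = (p32, p31, p30, p21, p20, p10)"
  shows "minor (subst_pair (a, b, 0, d) P) =
    (a^5*d*p32, a^4*d^2*p31, a^3*(b^2*d*p32 + b*d^2*p31 + d^3*p30),
     a^3*b*d^2*p31 + a^3*b^2*d*p32 + a^3*d^3*p21,
     a^2*b^2*d^2*p31 + a^2*b*d^3*(p30 + p21) + a^2*d^4*p20,
     a*d*(b^4*p32 + b^2*d^2*(p30 + p21) + d^4*p10))"
proof -
  obtain g h where P: "P = (g, h)" by (cases P)
  show ?thesis using assms
    apply (cases g; cases h)
    apply (clarsimp simp: P subst_pair_def)
    apply (simp add: algebra_simps power2_eq_square power3_eq_cube power4_eq_xxxx eval_nat_numeral)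
    done
qed

lemma resultant_triangular:
  fixes P :: "'a quad \<times> 'a quad"
  shows "resultant (subst_pair (a, b, 0, d) P) = (a*d)^9 * resultant P"
proof -
  obtain p32 p31 p30 p21 p20 p10 where p: "minor P = (p32, p31, p30, p21, p20, p10)"
    by (metis prod.collapse)
  show ?thesis unfolding resultant_def p minor_triangular[OF p] 
    by (simp add: algebra_simps eval_nat_numeral)
qed

end

fun label_pencil :: "'a::comm_ring_1 \<Rightarrow> 'a \<Rightarrow> 'a label \<Rightarrow> 'a quad \<times> 'a quad" where
  "label_pencil \<sigma> \<theta> Form_i = ((0, 0, 0, 1), (1, 0, 0, 0))"
| "label_pencil \<sigma> \<theta> Form_ii = ((\<sigma>, \<sigma>, 0, 1), (\<sigma> + 1, 1, 1, 0))"
| "label_pencil \<sigma> \<theta> Form_iii = ((0, 0, 1, 1), (1, 0, 0, 0))"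
| "label_pencil \<sigma> \<theta> Form_iv = ((1, 0, 0, 1), (0, 1, 0, 0))"
| "label_pencil \<sigma> \<theta> Form_iv_theta = ((\<theta>, 0, 0, 1), (0, 1, 0, 0))"
| "label_pencil \<sigma> \<theta> Form_iv_theta2 = ((\<theta>^2, 0, 0, 1), (0, 1, 0, 0))"
| "label_pencil \<sigma> \<theta> (Form_v c) = ((c, 0, 0, 1), (c, 1, 0, 0))"
| "label_pencil \<sigma> \<theta> (Form_vi b) = (((b + 1) * \<sigma>, \<sigma>, b, 1), (b + 1 + \<sigma>, 1, 1, 0))"

lemma representative_label_pencil: "representative \<sigma> \<theta> l = pencil_fract (label_pencil \<sigma> \<theta> l)"
  by (cases l) (simp_all add: pencil_fract_def one_pCons)

text \<open>Roots are taken on the projective line, with \<open>(1 : 0)\<close> allowed; otherwise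
  the property would not be invariant under substitutions.\<close>

definition wronsk_has_root :: "('a::comm_ring_1 quad \<times> 'a quad) \<Rightarrow> bool" where
  "wronsk_has_root P \<longleftrightarrow> (case wronsk P of (w4, w2, w0) \<Rightarrow>
    \<exists>x z. (x \<noteq> 0 \<or> z \<noteq> 0) \<and> w4*x^4 + w2*x^2*z^2 + w0*z^4 = 0)"

context field_char_2
begin

lemma add_square: "(x + y :: 'a)^2 = x^2 + y^2"
  by (simp add: power2_eq_square algebra_simps)

lemma square_eq_iff_eq: "(x::'a)^2 = y^2 \<longleftrightarrow> x = y"
  by (metis add_square add_eq_0_iff2 power_eq_0_iff zero_neq_numeral)

text \<open>By the Bruhat decomposition it suffices to treat triangular matrices and the swap, which
  avoids expanding the resultant under a general substitution.\<close>

lemma resultant_subst: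
  fixes P :: "'a quad \<times> 'a quad"
  shows "resultant (subst_pair M P) = mat_det M ^ 9 * resultant P"
proof -
  obtain a b c d where M: "M = (a, b, c, d)" by (cases M)
  show ?thesis
  proof (cases "c = 0")
    case True
    then show ?thesis by (simp add: M resultant_triangular)
  next
    case False
    \<comment> \<open>\<open>s\<close> is the determinant divided by \<open>c\<close>, so the two
      triangular factors, of determinants \<open>s\<close> and \<open>c\<close>, together account
      for \<open>mat_det M\<close>.\<close>
    define s where "s = b + a*d/c"
    have "mat_mul (mat_mul (s, a/c, 0, 1) (0, 1, 1, 0)) (c, d, 0, 1) = M"
      using False by (simp add: M s_def algebra_simps)
    then have "subst_pair M P =
        subst_pair (c, d, 0, 1) (subst_pair (0, 1, 1, 0) (subst_pair (s, a/c, 0, 1) P))"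
      by (simp only: subst_pair_subst)
    moreover have "c * s = mat_det M"
      using False by (simp add: M s_def algebra_simps)
    ultimately show ?thesis
      by (simp add: resultant_triangular resultant_swap flip: power_mult_distrib mult.assoc)
  qed
qed

text \<open>\<open>k\<close> is \<open>det N * det M\<close>. In this form the resultant visibly
  scales by the cube of the factor of \<open>w2\<close>.\<close>

lemma pencil_equiv_wronsk:
  fixes P Q :: "'a quad \<times> 'a quad"
  assumes "pencil_equiv P Q" "wronsk P = (w4, w2, w0)"
  obtains a b c d k where "k \<noteq> 0" "a*d + b*c \<noteq> 0"
    "wronsk Q = (k * (w4*a^4 + w2*a^2*c^2 + w0*c^4), k * ((a*d + b*c)^2 * w2),
      k * (w4*b^4 + w2*b^2*d^2 + w0*d^4))"
    "resultant Q = (k * (a*d + b*c)^2)^3 * resultant P"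
proof -
  obtain N M where NM: "mat_det N \<noteq> 0" "mat_det M \<noteq> 0" "Q = row_op N (subst_pair M P)"
    using assms(1) unfolding pencil_equiv_def by blast
  obtain a b c d where M: "M = (a, b, c, d)" by (cases M)
  have det: "mat_det M = a*d + b*c" by (simp add: M)
  show thesis
  proof (rule that)
    show "mat_det N * mat_det M \<noteq> 0" using NM by simp
    show "a*d + b*c \<noteq> 0" using NM(2) by (simp add: det)
    show "wronsk Q = (mat_det N * mat_det M * (w4*a^4 + w2*a^2*c^2 + w0*c^4),
        mat_det N * mat_det M * ((a*d + b*c)^2 * w2), 
        mat_det N * mat_det M * (w4*b^4 + w2*b^2*d^2 + w0*d^4))"
      unfolding NM(3) wronsk_row_op[OF wronsk_subst[OF assms(2) M]] det
      by (simp add: power2_eq_square power3_eq_cube mult.assoc)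
    show "resultant Q = (mat_det N * mat_det M * (a*d + b*c)^2)^3 * resultant P"
      unfolding NM(3) resultant_row_op resultant_subst det
      by (simp add: eval_nat_numeral mult_ac)
  qed
qed

text \<open>The equality of the quotients resultant / \<open>w2^3\<close>, cross-multiplied so that
  it also makes sense for \<open>w2 = 0\<close>.\<close>

lemma pencil_equiv_resultant:
  fixes P Q :: "'a quad \<times> 'a quad"
  assumes "pencil_equiv P Q" "wronsk P = (w4, w2, w0)" "wronsk Q = (v4, v2, v0)"
  shows "resultant Q * w2^3 = resultant P * v2^3" "w2 = 0 \<longleftrightarrow> v2 = 0"
proof -
  obtain a b c d k where *: "k \<noteq> 0" "a*d + b*c \<noteq> 0"
    "wronsk Q = (k * (w4*a^4 + w2*a^2*c^2 + w0*c^4), k * ((a*d + b*c)^2 * w2),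
      k * (w4*b^4 + w2*b^2*d^2 + w0*d^4))"
    "resultant Q = (k * (a*d + b*c)^2)^3 * resultant P"
    by (rule pencil_equiv_wronsk[OF assms(1,2)])
  have v2: "v2 = k * (a*d + b*c)^2 * w2" using *(3) assms(3) by (simp add: mult.assoc)
  show "resultant Q * w2^3 = resultant P * v2^3"
    unfolding v2 *(4) power_mult_distrib by (simp add: mult_ac)
  show "w2 = 0 \<longleftrightarrow> v2 = 0" using * by (simp add: v2)
qed

lemma pencil_equiv_wronsk_has_root:
  fixes P Q :: "'a quad \<times> 'a quad"
  assumes "pencil_equiv P Q" "wronsk_has_root Q"
  shows "wronsk_has_root P"
proof -
  obtain w4 w2 w0 where w: "wronsk P = (w4, w2, w0)" by (metis prod.collapse)
  obtain a b c d k where *: "k \<noteq> 0" "a*d + b*c \<noteq> 0"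
    "wronsk Q = (k * (w4*a^4 + w2*a^2*c^2 + w0*c^4), k * ((a*d + b*c)^2 * w2),
      k * (w4*b^4 + w2*b^2*d^2 + w0*d^4))"
    by (rule pencil_equiv_wronsk[OF assms(1) w])
  obtain x z where xz: "x \<noteq> 0 \<or> z \<noteq> 0"
    "k * (w4*a^4 + w2*a^2*c^2 + w0*c^4)*x^4 + k * ((a*d + b*c)^2 * w2)*x^2*z^2
      + k * (w4*b^4 + w2*b^2*d^2 + w0*d^4)*z^4 = 0"
    using assms(2) unfolding wronsk_has_root_def *(3) by auto
  define x' z' where "x' = a*x + b*z" and "z' = c*x + d*z"
  have "k * (w4*x'^4 + w2*x'^2*z'^2 + w0*z'^4) = 0"
    unfolding xz(2)[symmetric] x'_def z'_def
    by (simp add: eval_nat_numeral algebra_simps)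
  then have "w4*x'^4 + w2*x'^2*z'^2 + w0*z'^4 = 0" using *(1) by simp
  moreover have "x' \<noteq> 0 \<or> z' \<noteq> 0"
  proof (rule ccontr)
    assume "\<not> ?thesis"
    \<comment> \<open>Applying the adjugate recovers \<open>(x, z)\<close> up to the nonzero
      determinant.\<close>
    then have "d * x' + b * z' = 0" "c * x' + a * z' = 0" by auto
    then have "(a*d + b*c) * x = 0" "(a*d + b*c) * z = 0"
      by (simp_all add: x'_def z'_def algebra_simps)
    then show False using xz(1) *(2) by simp
  qed
  ultimately show ?thesis unfolding wronsk_has_root_def w by auto
qed

text \<open>V has its double root at infinity for both pencils, so the substitution fixes infinity,
  that is, \<open>c = 0\<close>. Comparing coefficients then makes it diagonal, and a diagonal
  substitution changes the constant by the cube of \<open>d / a\<close>.\<close>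

lemma pencil_equiv_iv:
  fixes \<zeta> \<eta> :: 'a
  assumes "pencil_equiv ((\<zeta>, 0, 0, 1), (0, 1, 0, 0)) ((\<eta>, 0, 0, 1), (0, 1, 0, 0))" "\<zeta> \<noteq> 0"
  obtains y where "y \<noteq> 0" "\<eta> = \<zeta> * y^3"
proof -
  obtain N M where NM: "mat_det N \<noteq> 0" "mat_det M \<noteq> 0"
    "((\<eta>, 0, 0, 1), (0, 1, 0, 0)) = row_op N (subst_pair M ((\<zeta>, 0, 0, 1), (0, 1, 0, 0)))"
    using assms(1) unfolding pencil_equiv_def by blast
  obtain a b c d where M: "M = (a, b, c, d)" by (cases M)
  obtain e f k l where N: "N = (e, f, k, l)" by (cases N)
  have w: "wronsk ((\<zeta>, 0, 0, 1), (0, 1, 0, 0)) = (0, 0, \<zeta>)" by simp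
  have "wronsk ((\<eta>, 0, 0, 1), (0, 1, 0, 0)) = (0, 0, \<eta>)" by simp
  then have "mat_det N * (mat_det M * (\<zeta> * c^4)) = 0"
    unfolding NM(3) wronsk_row_op[OF wronsk_subst[OF w M]] by simp
  then have c: "c = 0" using NM(1,2) assms(2) by simp
  have ad: "a \<noteq> 0" "d \<noteq> 0" using NM(2) c by (auto simp: M)
  have k: "k = 0" using NM(3) ad by (simp add: N M c subst_pair_def)
  have l: "l \<noteq> 0" "e \<noteq> 0" using NM(1) k by (auto simp: N)
  have b: "b = 0" using NM(3) ad l by (simp add: N M c k subst_pair_def)
  have "e * a^3 = 1" "\<eta> = e * (d^3 * \<zeta>)"
    using NM(3) by (simp_all add: N M c k b subst_pair_def)
  then have "\<eta> = \<zeta> * (d / a)^3" using ad by (simp add: field_simps)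
  then show thesis using ad by (intro that[of "d / a"]) simp_all
qed

text \<open>Resultant and Wronskian agree here. But the roots of V are 0 and infinity for both
  pencils, so the substitution fixes or swaps them and is monomial; such substitutions preserve the
  span of \<open>x^3\<close> and \<open>1\<close>, which does not contain
  \<open>x^3 + x^2\<close>.\<close>

lemma not_pencil_equiv_i_iii:
  "\<not> pencil_equiv ((0, 0, 0, 1), (1, 0, 0, 0)) ((0, 0, 1, 1), (1, 0, 0, 0 :: 'a))"
proof
  assume "pencil_equiv ((0, 0, 0, 1), (1, 0, 0, 0)) ((0, 0, 1, 1), (1, 0, 0, 0 :: 'a))"
  then obtain N M :: "'a quad" where NM: "mat_det N \<noteq> 0" "mat_det M \<noteq> 0"
    "((0, 0, 1, 1), (1, 0, 0, 0)) = row_op N (subst_pair M ((0, 0, 0, 1), (1, 0, 0, 0)))"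
    unfolding pencil_equiv_def by blast
  obtain a b c d where M: "M = (a, b, c, d)" by (cases M)
  obtain e f k l where N: "N = (e, f, k, l)" by (cases N)
  have D: "mat_det N \<noteq> 0" "mat_det M \<noteq> 0" by fact+
  have w: "wronsk ((0, 0, 0, 1), (1, 0, 0, 0 :: 'a)) = (0, 1, 0)" by simp
  have "wronsk ((0, 0, 1, 1), (1, 0, 0, 0 :: 'a)) = (0, 1, 0)" by simp
  then have "mat_det N * (mat_det M * (a^2*c^2)) = 0" "mat_det N * (mat_det M * (b^2*d^2)) = 0"
    unfolding NM(3) wronsk_row_op[OF wronsk_subst[OF w M]] by auto
  then have "a = 0 \<or> c = 0" "b = 0 \<or> d = 0" using D by auto
  then have "b = 0 \<and> c = 0 \<or> a = 0 \<and> d = 0" using D(2) by (auto simp: M)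
  then show False using NM(3) by (auto simp: M N subst_pair_def)
qed

end

section \<open>Finite fields and uniqueness of the normal form\<close>

lemma finite_field_power_card:
  fixes x :: "'a::{finite,field}"
  shows "x ^ CARD('a) = x"
proof (cases "x = 0")
  case True
  then show ?thesis by (simp add: power_0_left)
next
  case False
  let ?U = "UNIV - {0 :: 'a}"
  have "bij_betw ((*) x) ?U ?U"
    by (rule bij_betw_byWitness[where f' = "\<lambda>y. y / x"]) (use False in auto)
  then have "(\<Prod>y\<in>?U. x * y) = (\<Prod>y\<in>?U. y)"
    by (rule prod.reindex_bij_betw)
  then have "x ^ card ?U * (\<Prod>y\<in>?U. y) = (\<Prod>y\<in>?U. y)"
    by (simp add: prod.distrib)
  then have "x ^ card ?U = 1" by simp
  moreover have "CARD('a) = Suc (card ?U)" by (rule card.remove) simp_all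
  ultimately show ?thesis by (simp only: power_Suc mult_1_right)
qed

locale finite_field_char_2 = field_char_2 ty for ty :: "'a::{finite,field} itself"
begin

lemma sqrt_exists:
  obtains y :: 'a where "y^2 = x"
proof -
  have "inj (\<lambda>y::'a. y^2)" by (rule injI) (simp add: square_eq_iff_eq)
  then have "surj (\<lambda>y::'a. y^2)" by (simp add: finite_UNIV_inj_surj)
  then show thesis using that by (metis surjE)
qed

text \<open>Among the additive subgroups whose order is a power of two, a largest one is the whole
  field, since adjoining an outside element \<open>a\<close> together with its coset doubles the
  order.\<close>

lemma card_power_of_2:
  obtains n where "CARD('a) = 2 ^ n"
proof -
  define C where "C S \<longleftrightarrow> (0::'a) \<in> S \<and> (\<forall>x\<in>S. \<forall>y\<in>S. x + y \<in> S) \<and> (\<exists>k. card S = 2 ^ k)" for S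
  have C0: "C {0}" by (auto simp: C_def intro: exI[of _ 0])
  have "\<forall>S. C S \<longrightarrow> card S < Suc CARD('a)" by (simp add: card_mono less_Suc_eq_le)
  from ex_has_greatest_nat[OF C0 this]
  obtain S where S: "C S" "\<And>T. C T \<Longrightarrow> card T \<le> card S" by auto
  have "S = UNIV"
  proof (rule ccontr)
    assume "S \<noteq> UNIV"
    then obtain a where a: "a \<notin> S" by blast
    obtain k where k: "card S = 2 ^ k" using S(1) C_def by blast
    have cl: "x + y \<in> S" if "x \<in> S" "y \<in> S" for x y using S(1) that C_def by blast
    define T where "T = S \<union> (+) a ` S"
    have "S \<inter> (+) a ` S = {}"
    proof (rule ccontr)
      assume "S \<inter> (+) a ` S \<noteq> {}"
      then obtain s where "s \<in> S" "a + s \<in> S" by blast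
      then have "(a + s) + s \<in> S" by (rule cl[rotated])
      then show False using a by (simp add: add.assoc)
    qed
    then have "card T = 2 ^ Suc k"
      by (simp add: T_def card_Un_disjoint card_image k)
    moreover have "C T"
    proof -
      have "x + y \<in> T" if xy: "x \<in> T" "y \<in> T" for x y
      proof -
        obtain s where s: "s \<in> S" "x = s \<or> x = a + s"
          using xy(1) unfolding T_def by blast
        obtain t where t: "t \<in> S" "y = t \<or> y = a + t"
          using xy(2) unfolding T_def by blast
        from s(2) t(2) have "x + y = s + t \<or> x + y = a + (s + t)"
          by (elim disjE) (simp_all add: ac_simps)
        then show ?thesis using cl[OF s(1) t(1)] by (auto simp: T_def)
      qed
      moreover have "0 \<in> T" using S(1) by (simp add: C_def T_def)
      ultimately show ?thesis using \<open>card T = 2 ^ Suc k\<close> unfolding C_def by blast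
    qed
    ultimately show False using S(2)[of T] k by simp
  qed
  then show thesis using S(1) that C_def by blast
qed

lemma add_power_2_power: "(x + y :: 'a) ^ 2 ^ n = x ^ 2 ^ n + y ^ 2 ^ n"
proof (induction n)
  case (Suc n)
  have "(x + y) ^ 2 ^ Suc n = ((x + y) ^ 2 ^ n) ^ 2" by (simp add: mult.commute flip: power_mult)
  also have "\<dots> = (x ^ 2 ^ n)^2 + (y ^ 2 ^ n)^2" by (simp add: Suc add_square)
  finally show ?case by (simp add: mult.commute flip: power_mult)
qed simp

text \<open>The conjugates of \<open>y^2 + y\<close> telescope to \<open>y^q + y = 0\<close>. The
  assumption that \<open>\<sigma>\<close> has trace 1 enters only through its consequence that
  \<open>\<sigma>\<close> is never \<open>y^2 + y\<close>.\<close>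

lemma abs_trace_artin_schreier: "abs_trace (y^2 + y :: 'a) = 0"
proof -
  obtain n where n: "CARD('a) = 2 ^ n" by (rule card_power_of_2)
  have "CARD('a) \<noteq> 1"
  proof
    assume "CARD('a) = 1"
    then have "(0::'a) = 1" by (metis card_1_singletonE UNIV_I singletonD)
    then show False by simp
  qed
  then obtain m where m: "n = Suc m" using n by (cases n) auto
  \<comment> \<open>Half of \<open>2 ^ Suc m\<close> is \<open>2 ^ m\<close>, so the exponents run
    up to \<open>m\<close> and not up to \<open>n\<close>.\<close>
  have set: "{i. 2 ^ i \<le> CARD('a) div 2} = {..m}" by (auto simp: n m)
  have tel: "(\<Sum>i\<le>m. (y^2 + y) ^ 2 ^ i) = y ^ 2 ^ Suc m + y" for m
  proof (induction m)
    case (Suc m)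
    have "(y^2) ^ 2 ^ Suc m = y ^ 2 ^ Suc (Suc m)" by (simp flip: power_mult)
    then have "(y^2 + y) ^ 2 ^ Suc m = y ^ 2 ^ Suc (Suc m) + y ^ 2 ^ Suc m"
      unfolding add_power_2_power by simp
    then show ?case unfolding sum.atMost_Suc Suc by (simp add: ac_simps)
  qed simp
  have "y ^ 2 ^ Suc m = y" using finite_field_power_card[of y] n m by simp
  then show ?thesis unfolding abs_trace_def set tel by simp
qed

text \<open>The fibres of the additive map \<open>y^2 + y\<close> are the pairs
  \<open>{y, y + 1}\<close>, so its image has \<open>q/2\<close> elements. The translate of the
  image by \<open>\<sigma>\<close> misses the image, hence fills its complement, where
  \<open>\<tau>\<close> lies.\<close>

lemma artin_schreier_index_2:
  fixes \<sigma> \<tau> :: 'a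
  assumes "\<And>y. y^2 + y \<noteq> \<sigma>" "\<And>y. y^2 + y \<noteq> \<tau>"
  obtains y where "y^2 + y = \<sigma> + \<tau>"
proof -
  let ?p = "\<lambda>y::'a. y^2 + y"
  let ?I = "range ?p"
  have p_add: "?p (x + y) = ?p x + ?p y" for x y
    by (simp add: add_square ac_simps)
  have p_iff: "?p x = ?p y \<longleftrightarrow> x = y \<or> x = y + 1" for x y
  proof -
    have "?p x = ?p y \<longleftrightarrow> ?p (x + y) = 0" unfolding p_add by (simp add: add_eq_0_iff2)
    also have "?p (x + y) = (x + y) * ((x + y) + 1)" by (simp add: power2_eq_square algebra_simps)
    also have "\<dots> = 0 \<longleftrightarrow> x = y \<or> x = y + 1"
      by (metis add_eq_0_iff2 mult_eq_0_iff add.assoc)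
    finally show ?thesis .
  qed
  have "card {y. ?p y = z} = 2" if z: "z \<in> ?I" for z
  proof -
    obtain y where y: "z = ?p y" using z by blast
    then have "{y. ?p y = z} = {y, y + 1}" by (auto simp: p_iff)
    then show ?thesis by simp
  qed
  then have "(\<Sum>z\<in>?I. card {y. ?p y = z}) = 2 * card ?I" by simp
  moreover have "CARD('a) = (\<Sum>z\<in>?I. card {y. ?p y = z})"
    using sum.image_gen[of "UNIV :: 'a set" "\<lambda>_. 1 :: nat" ?p] by simp
  ultimately have card: "CARD('a) = 2 * card ?I" by simp
  have sub: "(+) \<sigma> ` ?I \<subseteq> - ?I"
  proof
    fix u assume "u \<in> (+) \<sigma> ` ?I"
    then obtain w where w: "u = \<sigma> + ?p w" by blast
    have "u \<notin> ?I"
    proof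
      assume "u \<in> ?I"
      then obtain t where t: "u = ?p t" by blast
      have "\<sigma> = u + ?p w" by (simp only: w add.assoc add_self add_0_right)
      then have "?p (t + w) = \<sigma>" by (simp only: p_add t)
      then show False using assms(1) by blast
    qed
    then show "u \<in> - ?I" by blast
  qed
  have "card (- ?I) = card ?I" using card by (simp add: Compl_eq_Diff_UNIV card_Diff_subset)
  then have "(+) \<sigma> ` ?I = - ?I"
    by (intro card_subset_eq sub) (simp_all add: card_image)
  moreover have "\<tau> \<in> - ?I" using assms(2) by blast
  ultimately have "\<tau> \<in> (+) \<sigma> ` ?I" by (simp only:)
  then obtain y where "\<tau> = \<sigma> + ?p y" by blast
  then have "?p y = \<sigma> + \<tau>" by simp
  then show thesis by (rule that)
qed

text \<open>Cubing has fibres of at most three elements, so there are at least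
  \<open>(q - 1)/3\<close> nonzero cubes \<open>C\<close>. The sets \<open>C\<close>,
  \<open>\<theta> C\<close> and \<open>\<theta>^2 C\<close> are disjoint and therefore exhaust the
  nonzero elements.\<close>

lemma cube_classes:
  fixes \<theta> \<zeta> :: 'a
  assumes "\<And>y. \<theta> \<noteq> y^3" "\<zeta> \<noteq> 0"
  obtains y where "y \<noteq> 0" "\<zeta> = y^3 \<or> \<zeta> = \<theta> * y^3 \<or> \<zeta> = \<theta>^2 * y^3"
proof -
  have nz: "\<theta> \<noteq> 0" using assms(1)[of 0] by simp
  define U where "U = - {0 :: 'a}"
  define C where "C = (\<lambda>y. y^3) ` U"
  have C0: "0 \<notin> C" by (auto simp: C_def U_def)
  have fibre: "card {y \<in> U. y^3 = z} \<le> 3" for z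
  proof -
    have ne: "[:- z, 0, 0, 1:] \<noteq> 0" by simp
    have "{y \<in> U. y^3 = z} \<subseteq> {y. poly [:- z, 0, 0, 1:] y = 0}"
      by (auto simp: power3_eq_cube)
    then have "card {y \<in> U. y^3 = z} \<le> card {y. poly [:- z, 0, 0, 1:] y = 0}"
      by (intro card_mono) simp_all
    also have "\<dots> \<le> Polynomial.degree [:- z, 0, 0, 1:]"
      by (rule card_poly_roots_bound[OF ne])
    finally show ?thesis by simp
  qed
  have "card U = (\<Sum>z\<in>C. card {y \<in> U. y^3 = z})"
    using sum.image_gen[of U "\<lambda>_. 1 :: nat" "\<lambda>y. y^3"] by (simp add: C_def)
  also have "\<dots> \<le> (\<Sum>z\<in>C. 3)" by (rule sum_mono) (rule fibre)
  finally have le: "card U \<le> 3 * card C" by simp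
  have disj: "C \<inter> (*) \<theta> ` C = {}" "C \<inter> (*) (\<theta>^2) ` C = {}" "(*) \<theta> ` C \<inter> (*) (\<theta>^2) ` C = {}"
  proof -
    have quot: "x^3 \<noteq> \<theta> * y^3" if "y \<noteq> 0" for x y
    proof
      assume "x^3 = \<theta> * y^3"
      then have "\<theta> = (x / y)^3" using that by (simp add: field_simps)
      then show False using assms(1) by blast
    qed
    have quot2: "x^3 \<noteq> \<theta>^2 * y^3" if "y \<noteq> 0" for x y
    proof
      assume *: "x^3 = \<theta>^2 * y^3"
      \<comment> \<open>A further factor \<open>\<theta>\<close> turns \<open>\<theta>^2\<close>
        into a cube and reduces to the previous case.\<close>
      then have "(\<theta> * y)^3 = \<theta> * x^3" by (simp add: power_mult_distrib power2_eq_square power3_eq_cube)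
      moreover have "x \<noteq> 0" using * that nz by auto
      ultimately show False using quot by blast
    qed
    show "C \<inter> (*) \<theta> ` C = {}" "C \<inter> (*) (\<theta>^2) ` C = {}"
      using quot quot2 by (auto simp: C_def U_def)
    show "(*) \<theta> ` C \<inter> (*) (\<theta>^2) ` C = {}"
      using nz by (auto simp: C_def U_def power2_eq_square mult.assoc) (use quot in blast)
  qed
  define D where "D = C \<union> (*) \<theta> ` C \<union> (*) (\<theta>^2) ` C"
  have inj: "inj_on ((*) \<theta>) C" "inj_on ((*) (\<theta>^2)) C" using nz by (auto intro: inj_onI)
  have "card D = 3 * card C"
    unfolding D_def using disj inj
    by (simp add: card_Un_disjoint Int_Un_distrib2 card_image)
  moreover have DU: "D \<subseteq> U" using C0 nz by (auto simp: D_def U_def)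
  moreover have "card D \<le> card U" by (rule card_mono[OF _ DU]) simp
  ultimately have "D = U" using le by (intro card_subset_eq) simp_all
  then have "\<zeta> \<in> D" using assms(2) by (simp add: U_def)
  then show thesis using that by (auto simp: D_def C_def U_def)
qed

text \<open>An odd power of two is \<open>3t + 2\<close>, so \<open>q - 1 = 3t + 1\<close> is prime
  to 3. The identity \<open>3(2t + 1) = 2(q - 1) + 1\<close> exhibits a cube root of
  \<open>\<zeta>\<close> as a power of \<open>\<zeta>\<close>.\<close>

lemma nonsquare_card_cube:
  fixes \<zeta> :: 'a
  assumes "\<nexists>m. CARD('a) = m^2"
  obtains y where "\<zeta> = y^3"
proof (cases "\<zeta> = 0")
  case True
  then show ?thesis by (intro that[of 0]) simp
next
  case False
  obtain n where n: "CARD('a) = 2 ^ n" by (rule card_power_of_2)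
  have "odd n"
  proof
    assume "even n"
    then obtain k where "n = 2 * k" by (rule evenE)
    then have "CARD('a) = (2 ^ k)^2" by (simp add: n mult.commute flip: power_mult)
    then show False using assms by blast
  qed
  then obtain k where k: "n = 2 * k + 1" by (rule oddE)
  have "\<exists>t. (2::nat) ^ (2 * k + 1) = 3 * t + 2"
  proof (induction k)
    case (Suc k)
    then obtain t where "(2::nat) ^ (2 * k + 1) = 3 * t + 2" by blast
    then have "(2::nat) ^ (2 * Suc k + 1) = 3 * (4 * t + 2) + 2" by simp
    then show ?case by blast
  qed simp
  then obtain t where t: "CARD('a) = 3 * t + 2" by (auto simp: n k)
  have "\<zeta> * \<zeta> ^ (3 * t + 1) = \<zeta>" using finite_field_power_card[of \<zeta>] by (simp add: t)
  then have 1: "\<zeta> ^ (3 * t + 1) = 1" using False by simp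
  have e: "(2 * t + 1) * 3 = (3 * t + 1) + (3 * t + 1) + 1" by simp
  have "(\<zeta> ^ (2 * t + 1))^3 = \<zeta> ^ (3 * t + 1) * \<zeta> ^ (3 * t + 1) * \<zeta>"
    unfolding power_mult[symmetric] e by (simp only: power_add power_one_right)
  then show ?thesis by (intro that[of "\<zeta> ^ (2 * t + 1)"]) (simp only: 1 mult_1_left)
qed

text \<open>Vanishing of \<open>w2\<close> isolates family (iv), where the cube classes decide.
  Otherwise a rational root of V tells (i), (iii), (v) from (ii), (vi), and within each group the
  quotient of resultant and \<open>w2^3\<close> finds the parameter, leaving only (i) against
  (iii).\<close>

lemma label_unique:
  fixes \<sigma> \<theta> :: 'a
  assumes sigma: "\<And>y. y^2 + y \<noteq> \<sigma>"
    and theta: "(\<exists>m. CARD('a) = m^2) \<Longrightarrow> \<nexists>y. \<theta> = y^3"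
    and adm: "admissible l" "admissible l'"
    and eq: "pencil_equiv (label_pencil \<sigma> \<theta> l) (label_pencil \<sigma> \<theta> l')"
  shows "l = l'"
proof -
  let ?P = "label_pencil \<sigma> \<theta>"
  define iv where "iv l \<longleftrightarrow> l \<in> {Form_iv, Form_iv_theta, Form_iv_theta2}" for l :: "'a label"
  define split where "split l \<longleftrightarrow> l \<in> {Form_i, Form_iii} \<union> range Form_v" for l :: "'a label"
  have wronsk_iv: "wronsk (?P l) = (w4, w2, w0) \<Longrightarrow> admissible l \<Longrightarrow> w2 = 0 \<longleftrightarrow> iv l" for l w4 w2 w0
    by (cases l) (auto simp: iv_def algebra_simps)
  \<comment> \<open>For (v) the resultant is \<open>(c + 1)^2 * c\<close>; its last factor is
    \<open>w2\<close>.\<close>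
  have res1: "wronsk (?P l) = (w4, w2, w0) \<Longrightarrow> resultant (?P l) =
      (case l of Form_v c \<Rightarrow> (c + 1)^2 * w2 | Form_vi b \<Rightarrow> (b + 1)^4 | Form_iv \<Rightarrow> 1 | Form_iv_theta \<Rightarrow> \<theta>
        | Form_iv_theta2 \<Rightarrow> \<theta>^2 | _ \<Rightarrow> 1)" for l w4 w2 w0
    by (cases l) (auto simp: resultant_def algebra_simps eval_nat_numeral)
  have rootI: "wronsk_has_root P" if fst: "fst (wronsk P) = 0" for P :: "'a quad \<times> 'a quad"
  proof -
    obtain w2 w0 where w: "wronsk P = (0, w2, w0)" using fst by (metis prod.collapse)
    show ?thesis
      unfolding wronsk_has_root_def w prod.case by (rule exI[of _ 1], rule exI[of _ 0]) simp
  qed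
  have split_root: "wronsk_has_root (?P l)" if "split l" for l
    using that by (auto simp: split_def intro!: rootI)
  have nonsplit_root: "\<not> wronsk_has_root (?P l)" if nl: "\<not> split l" "\<not> iv l" for l
  proof
    assume "wronsk_has_root (?P l)"
    moreover have "wronsk (?P l) = (1, 1, \<sigma>^2)"
      using nl by (cases l) (auto simp: split_def iv_def algebra_simps power2_eq_square)
    ultimately obtain x z where xz: "x \<noteq> 0 \<or> z \<noteq> 0" "x^4 + x^2*z^2 + \<sigma>^2*z^4 = 0"
      by (auto simp: wronsk_has_root_def)
    \<comment> \<open>The Wronskian of (ii) and (vi) is the square of this norm form, whose root
      \<open>x / z\<close> would write \<open>\<sigma>\<close> as \<open>y^2 + y\<close>.\<close>
    have "(x^2 + x*z + \<sigma>*z^2)^2 = x^4 + x^2*z^2 + \<sigma>^2*z^4"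
      by (simp add: add_square power_mult_distrib flip: power_mult)
    then have 0: "x^2 + x*z + \<sigma>*z^2 = 0" using xz(2) by simp
    have "z \<noteq> 0" using 0 xz(1) by auto
    then have "(x / z)^2 + x / z + \<sigma> = 0" using 0 by (simp add: field_simps power2_eq_square)
    then show False using sigma[of "x / z"] by (simp add: add_eq_0_iff2)
  qed
  obtain w4 w2 w0 where w: "wronsk (?P l) = (w4, w2, w0)" by (metis prod.collapse)
  obtain v4 v2 v0 where v: "wronsk (?P l') = (v4, v2, v0)" by (metis prod.collapse)
  note res = pencil_equiv_resultant[OF eq w v]
  have iv_eq: "iv l \<longleftrightarrow> iv l'" using res(2) wronsk_iv[OF w adm(1)] wronsk_iv[OF v adm(2)] by simp
  have split_eq: "split l \<longleftrightarrow> split l'" if "\<not> iv l"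
    using pencil_equiv_wronsk_has_root[OF eq] pencil_equiv_wronsk_has_root[OF pencil_equiv_sym[OF eq]]
      split_root nonsplit_root iv_eq that by blast
  show ?thesis
  proof (cases "iv l")
    case True
    define \<zeta> where "\<zeta> l = (if l = Form_iv then 1 else if l = Form_iv_theta then \<theta> else \<theta>^2)" for l :: "'a label"
    have P: "?P l = ((\<zeta> l, 0, 0, 1), (0, 1, 0, 0))" if "iv l" for l
      using that by (auto simp: iv_def \<zeta>_def)
    have l': "iv l'" using True iv_eq by simp
    show ?thesis
    proof (cases "\<exists>m. CARD('a) = m^2")
      case False
      then show ?thesis using True l' adm by (auto simp: iv_def)
    next
      case sq: True
      then have nc: "\<theta> \<noteq> y^3" for y using theta by blast
      have nz: "\<theta> \<noteq> 0" using nc[of 0] by simp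
      \<comment> \<open>Together with \<open>nc\<close>, the following facts say that no quotient of
        two different members of \<open>1\<close>, \<open>\<theta>\<close>,
        \<open>\<theta>^2\<close> is a cube.\<close>
      have nc1: "\<theta> * y^3 \<noteq> 1" for y
      proof
        assume *: "\<theta> * y^3 = 1"
        then have "y \<noteq> 0" by auto
        then have "\<theta> = (1 / y)^3" using * by (simp add: power_divide eq_divide_eq)
        then show False using nc by blast
      qed
      have nc2: "\<theta>^2 * y^3 \<noteq> 1" for y
      proof
        assume *: "\<theta>^2 * y^3 = 1"
        have "\<theta> = \<theta> * (\<theta>^2 * y^3)" by (simp only: * mult_1_right)
        also have "\<dots> = (\<theta> * y)^3" by (simp add: power2_eq_square power3_eq_cube mult_ac)
        finally show False using nc by blast
      qed
      have nc3: "\<theta>^2 \<noteq> y^3" for y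
      proof
        assume *: "\<theta>^2 = y^3"
        then have "y \<noteq> 0" using nz by auto
        have "\<theta> * y^3 = \<theta>^3" by (simp only: *[symmetric]) (simp add: power2_eq_square power3_eq_cube)
        then have "\<theta> = (\<theta> / y)^3" using \<open>y \<noteq> 0\<close> by (simp add: field_simps)
        then show False using nc by blast
      qed
      have "\<zeta> l \<noteq> 0" using nz by (simp add: \<zeta>_def)
      then obtain y where y: "y \<noteq> 0" "\<zeta> l' = \<zeta> l * y^3"
        using pencil_equiv_iv[OF eq[unfolded P[OF True] P[OF l']]] by blast
      have nc4: "\<theta> \<noteq> \<theta>^2 * y^3" "\<theta>^2 \<noteq> \<theta> * y^3"
        using nz nc1[of y] nc[of y] by (simp_all add: power2_eq_square mult.assoc) 
      show ?thesis
        using True l' y(2) nc[of y] nc1[of y] nc2[of y] nc3[of y] nc4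
        by (auto simp: iv_def \<zeta>_def split: if_splits)
    qed
  next
    case False
    note niv = False False[unfolded iv_eq]
    show ?thesis
    proof (cases "split l")
      case True
      note sp = True True[unfolded split_eq[OF False]]
      \<comment> \<open>Equality of the invariants of two members of (v): after division by
        \<open>c * d\<close> both sides are squares.\<close>
      have cancel: "c = d" if "(d + 1)^2 * d * c^3 = (c + 1)^2 * c * d^3" "c \<noteq> 0" "d \<noteq> 0" for c d :: 'a
      proof -
        have "(c*d) * ((d + 1)^2 * c^2) = (c*d) * ((c + 1)^2 * d^2)"
          using that(1) by (simp add: eval_nat_numeral mult_ac)
        then have "((d + 1) * c)^2 = ((c + 1) * d)^2" using that(2,3) by (simp add: power_mult_distrib)
        then have "(d + 1) * c = (c + 1) * d" by (simp only: square_eq_iff_eq)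
        then show ?thesis by (simp add: algebra_simps)
      qed
      \<comment> \<open>A member of (v) with invariant 1 would satisfy
        \<open>(c + 1)^2 = c^2\<close>, hence \<open>c + 1 = c\<close>.\<close>
      have cancel1: "False" if "(c + 1)^2 * c = c^3" "c \<noteq> 0" for c :: 'a
      proof -
        have "c * (c + 1)^2 = c * c^2"
          using that(1) by (simp add: eval_nat_numeral mult_ac)
        then have "c + 1 = c" using that(2) by (simp add: square_eq_iff_eq)
        then show False by simp
      qed
      have shape: "(l \<in> {Form_i, Form_iii} \<and> w2 = 1) \<or> (\<exists>c. l = Form_v c \<and> c \<noteq> 0 \<and> w2 = c)"
        if "wronsk (?P l) = (w4, w2, w0)" "split l" "admissible l" for l w4 w2 w0
        using that by (auto simp: split_def)
      have r: "resultant (?P l') * w2^3 = resultant (?P l) * v2^3" by (rule res(1))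
      from shape[OF w sp(1) adm(1)] show ?thesis
      proof (elim disjE exE conjE)
        assume l: "l \<in> {Form_i, Form_iii}" "w2 = 1"
        have rl: "resultant (?P l) = 1" using l(1) unfolding res1[OF w] by auto
        from shape[OF v sp(2) adm(2)] show ?thesis
        proof (elim disjE exE conjE)
          assume "l' \<in> {Form_i, Form_iii}"
          then show ?thesis
            using l(1) eq pencil_equiv_sym[OF eq] not_pencil_equiv_i_iii by auto
        next
          fix c assume "l' = Form_v c" "c \<noteq> 0" "v2 = c"
          then show ?thesis using r[unfolded res1[OF v] rl] l cancel1[of c] by simp
        qed
      next
        fix c assume l: "l = Form_v c" "c \<noteq> 0" "w2 = c"
        from shape[OF v sp(2) adm(2)] show ?thesis
        proof (elim disjE exE conjE)
          assume l': "l' \<in> {Form_i, Form_iii}" "v2 = 1"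
          have "resultant (?P l') = 1" using l'(1) unfolding res1[OF v] by auto
          then show ?thesis using r[unfolded res1[OF w]] l l' cancel1[of c] by simp
        next
          fix d assume l': "l' = Form_v d" "d \<noteq> 0" "v2 = d"
          then show ?thesis using r[unfolded res1[OF w] res1[OF v]] l cancel[of d c] by simp
        qed
      qed
    next
      case False
      have nsp: "\<not> split l" "\<not> split l'" using False split_eq niv by auto
      have w2: "w2 = 1" "v2 = 1" using w v nsp niv by (cases l; cases l'; auto simp: split_def iv_def algebra_simps)+
      have "(x + 1)^4 = (y + 1)^4 \<longleftrightarrow> x = y" for x y :: 'a
      proof -
        have "(x + 1)^4 = ((x + 1)^2)^2" "(y + 1)^4 = ((y + 1)^2)^2" by (simp_all flip: power_mult)
        then show ?thesis by (simp only: square_eq_iff_eq add_right_cancel)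
      qed
      \<comment> \<open>The instances at 0 compare (vi) with (ii), which is its member
        \<open>b = 0\<close>.\<close>
      note inj = this this[where y = 0, simplified] this[where x = 0, simplified]
      show ?thesis
        using nsp niv res(1) adm
        unfolding res1[OF w] res1[OF v] w2
        by (cases l; cases l') (auto simp: split_def iv_def inj)
    qed
  qed
qed

end

section \<open>Existence of the normal form\<close>

context field_char_2
begin

text \<open>The first equation is the Pluecker relation for lines in projective 3-space.\<close>

lemma minor_relation:
  fixes P :: "'a quad \<times> 'a quad"
  assumes "minor P = (p32, p31, p30, p21, p20, p10)"
  shows "p32*p10 = p31*p20 + p30*p21" "wronsk P = (p32, p30 + p21, p10)"
proof -
  obtain g h where P: "P = (g, h)" by (cases P)
  show "p32*p10 = p31*p20 + p30*p21" using assms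
    by (cases g; cases h) (clarsimp simp: P algebra_simps)
  show "wronsk P = (p32, p30 + p21, p10)" using assms
    by (cases g; cases h) (clarsimp simp: P algebra_simps)
qed

text \<open>Cramer's rule: \<open>N\<close> inverts the block of coefficients of \<open>x^3\<close>
  and \<open>x^2\<close>, whose determinant is \<open>p32\<close>, and turns every other entry into
  a quotient of minors.\<close>

lemma pencil_equiv_echelon:
  fixes P :: "'a quad \<times> 'a quad"
  assumes "minor P = (p32, p31, p30, p21, p20, p10)" "p32 \<noteq> 0"
  shows "pencil_equiv P ((p20/p32, p21/p32, 0, 1), (p30/p32, p31/p32, 1, 0))"
proof -
  obtain g0 g1 g2 g3 h0 h1 h2 h3 where P: "P = ((g0, g1, g2, g3), (h0, h1, h2, h3))"
    by (metis prod.collapse)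
  have p: "p32 = g3*h2 + g2*h3" "p31 = g3*h1 + g1*h3" "p30 = g3*h0 + g0*h3"
    "p21 = g2*h1 + g1*h2" "p20 = g2*h0 + g0*h2"
    using assms(1) by (auto simp: P)
  define N where "N = (h2/p32, g2/p32, h3/p32, g3/p32)"
  have "mat_det N = (h2*g3 + g2*h3)/p32^2"
    by (simp add: N_def add_divide_distrib power2_eq_square)
  also have "h2*g3 + g2*h3 = p32" by (simp add: p(1) mult.commute)
  finally have "mat_det N \<noteq> 0" using assms(2) by simp
  then have "pencil_equiv P (row_op N P)" by (rule pencil_equiv_row_op)
  also have "row_op N P = ((p20/p32, p21/p32, 0, 1), (p30/p32, p31/p32, 1, 0))"
  proof -
    have "h2*g0 + g2*h0 = p20" "h2*g1 + g2*h1 = p21" "h2*g2 + g2*h2 = 0" "h2*g3 + g2*h3 = p32"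
      "h3*g0 + g3*h0 = p30" "h3*g1 + g3*h1 = p31" "h3*g2 + g3*h2 = p32" "h3*g3 + g3*h3 = 0"
      by (simp_all add: p ac_simps)
    then show ?thesis using assms(2) by (simp add: N_def P flip: add_divide_distrib)
  qed
  finally show ?thesis .
qed

text \<open>V has its roots at 0 and infinity, and \<open>w2 = 1 + \<beta> * \<gamma>\<close>, so
  the hypothesis keeps them distinct. Scaling leaves only the product
  \<open>\<beta> * \<gamma>\<close> when it is nonzero; swapping the two points exchanges the roles
  of \<open>\<beta>\<close> and \<open>\<gamma>\<close>.\<close>

lemma pencil_equiv_group_A:
  fixes \<beta> \<gamma> \<sigma> \<theta> :: 'a
  assumes "\<beta> * \<gamma> \<noteq> 1"
  obtains l where "l \<in> {Form_i, Form_iii} \<union> Form_v ` (- {0, 1})"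
    "pencil_equiv ((0, 0, \<beta>, 1), (1, \<gamma>, 0, 0)) (label_pencil \<sigma> \<theta> l)"
proof -
  have iii: "pencil_equiv ((0, 0, \<beta>, 1), (1, 0, 0, 0)) (label_pencil \<sigma> \<theta> Form_iii)" if "\<beta> \<noteq> 0" for \<beta>
  proof -
    have "label_pencil \<sigma> \<theta> Form_iii = row_op (1/\<beta>^3, 0, 0, 1) (subst_pair (\<beta>, 0, 0, 1) ((0, 0, \<beta>, 1), (1, 0, 0, 0)))"
      using that by (simp add: subst_pair_def power2_eq_square power3_eq_cube)
    moreover have "mat_det (1/\<beta>^3, 0, 0, 1) \<noteq> 0" "mat_det (\<beta>, 0, 0, 1) \<noteq> 0" using that by simp_all
    ultimately show ?thesis unfolding pencil_equiv_def by blast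
  qed
  consider "\<beta> = 0" "\<gamma> = 0" | "\<beta> \<noteq> 0" "\<gamma> = 0" | "\<beta> = 0" "\<gamma> \<noteq> 0" | "\<beta> \<noteq> 0" "\<gamma> \<noteq> 0" by blast
  then show thesis
  proof cases
    case 1
    have "pencil_equiv ((0, 0, \<beta>, 1), (1, \<gamma>, 0, 0)) (row_op (1, 0, 0, 1) ((0, 0, \<beta>, 1), (1, \<gamma>, 0, 0)))"
      by (rule pencil_equiv_row_op) simp
    then show thesis using 1 by (intro that[of Form_i]) simp_all
  next
    case 2
    then show thesis using iii[of \<beta>] by (intro that[of Form_iii]) simp_all
  next
    case 3
    have "((0, 0, \<gamma>, 1), (1, 0, 0, 0)) = row_op (0, 1, 1, 0) (subst_pair (0, 1, 1, 0) ((0, 0, \<beta>, 1), (1, \<gamma>, 0, 0)))"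
      using 3 by (simp add: subst_pair_def)
    moreover have "mat_det (0, 1, 1, 0 :: 'a) \<noteq> 0" by simp
    ultimately have "pencil_equiv ((0, 0, \<beta>, 1), (1, \<gamma>, 0, 0)) ((0, 0, \<gamma>, 1), (1, 0, 0, 0))"
      unfolding pencil_equiv_def by blast
    also note iii[OF 3(2)]
    finally show thesis by (intro that[of Form_iii]) simp_all
  next
    case 4
    \<comment> \<open>The roots of V for (v) are 1 and infinity, so \<open>x\<close> is replaced by
      \<open>\<beta> x + \<beta>\<close>. The denominator becomes
      \<open>\<beta> \<gamma> (x + c)\<close> and the numerator \<open>\<beta>^3 (x^3 + x)\<close>;
      adding the normalised denominator to the normalised numerator gives
      \<open>x^3 + c\<close>.\<close>
    define c where "c = 1 + 1/(\<beta>*\<gamma>)"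
    have c: "c \<noteq> 0" "c \<noteq> 1" using 4 assms by (auto simp: c_def add_eq_0_iff2 eq_divide_eq)
    have "label_pencil \<sigma> \<theta> (Form_v c) =
       row_op (1/\<beta>^3, 1/(\<beta>*\<gamma>), 0, 1/(\<beta>*\<gamma>)) (subst_pair (\<beta>, \<beta>, 0, 1) ((0, 0, \<beta>, 1), (1, \<gamma>, 0, 0)))"
      using 4 by (simp add: subst_pair_def c_def field_simps power2_eq_square power3_eq_cube)
    moreover have "mat_det (1/\<beta>^3, 1/(\<beta>*\<gamma>), 0, 1/(\<beta>*\<gamma>)) \<noteq> 0" "mat_det (\<beta>, \<beta>, 0, 1) \<noteq> 0"
      using 4 by simp_all
    ultimately have "pencil_equiv ((0, 0, \<beta>, 1), (1, \<gamma>, 0, 0)) (label_pencil \<sigma> \<theta> (Form_v c))"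
      unfolding pencil_equiv_def by blast
    then show thesis using c by (intro that[of "Form_v c"]) simp_all
  qed
qed

text \<open>A root of V at infinity means that the coefficient columns of \<open>x^3\<close> and
  \<open>x^2\<close> are proportional, so one form can be reduced to degree at most 1. If both cubic
  coefficients vanished, infinity would be a common root of the pencil.\<close>

lemma pencil_equiv_root_at_infinity:
  fixes P Q :: "'a quad \<times> 'a quad"
  assumes "reduced_cubic P" "pencil_equiv P Q" "wronsk Q = (0, w2, w0)"
  obtains g0 g1 \<beta> h0 h1 where "pencil_equiv P ((g0, g1, \<beta>, 1), (h0, h1, 0, 0))"
    "w2 = 0 \<longleftrightarrow> h0 = \<beta> * h1" "w0 = 0 \<longleftrightarrow> g1 * h0 = g0 * h1"
proof -
  obtain g0 g1 g2 g3 h0 h1 h2 h3 where Q: "Q = ((g0, g1, g2, g3), (h0, h1, h2, h3))"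
    by (metis prod.collapse)
  note goal = that
  have main: thesis if N: "mat_det N \<noteq> 0" "row_op N Q = ((x0, x1, x2, 1), (y0, y1, 0, 0))" for N x0 x1 x2 y0 y1
  proof (rule goal)
    show "pencil_equiv P ((x0, x1, x2, 1), (y0, y1, 0, 0))"
      using assms(2) pencil_equiv_row_op[OF N(1), of Q] N(2) pencil_equiv_trans by metis
    have "wronsk (row_op N Q) = (0, mat_det N * w2, mat_det N * w0)"
      using wronsk_row_op[OF assms(3)] by simp
    then have "mat_det N * w2 = y0 + x2 * y1" "mat_det N * w0 = x1 * y0 + x0 * y1"
      by (simp_all add: N(2))
    then show "w2 = 0 \<longleftrightarrow> y0 = x2 * y1" "w0 = 0 \<longleftrightarrow> x1 * y0 = x0 * y1"
      using N(1) by (metis add_eq_0_iff2 mult_eq_0_iff)+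
  qed
  have w4: "g3 * h2 = g2 * h3" using assms(3) by (simp add: Q add_eq_0_iff2)
  consider "g3 \<noteq> 0" | "h3 \<noteq> 0" | "g3 = 0" "h3 = 0" by blast
  then show thesis
  proof cases
    case 1
    have "h3/g3*g2 + h2 = 0" using 1 w4 by (simp add: add_eq_0_iff2 field_simps)
    then show thesis
      using 1 by (intro main[of "(1/g3, 0, h3/g3, 1)"]) (simp_all add: Q)
  next
    case 2
    have "g2 + g3/h3*h2 = 0" using 2 w4 by (simp add: add_eq_0_iff2 field_simps)
    then show thesis
      using 2 by (intro main[of "(0, 1/h3, 1, g3/h3)"]) (simp_all add: Q)
  next
    case 3
    have "Q = (lin_quad_mult (1, 0) (g0, g1, g2), lin_quad_mult (1, 0) (h0, h1, h2))"
      by (simp add: Q 3)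
    then show thesis using reduced_cubic_no_linear_factor[of P "(1, 0)"] assms(1,2) by fastforce
  qed
qed

end

section \<open>Rational roots of the Wronskian: the split and the wild case\<close>

context finite_field_char_2
begin

lemma label_exists_split:
  fixes \<sigma> \<theta> :: 'a
  assumes "reduced_cubic P" "pencil_equiv P Q" "wronsk Q = (0, w2, w0)" "w2 \<noteq> 0"
  obtains l where "admissible l" "pencil_equiv P (label_pencil \<sigma> \<theta> l)"
proof -
  \<comment> \<open>This is the second root of V; the translation by \<open>x\<close> moves it to 0
    and keeps the first at infinity.\<close>
  obtain x where x: "x^2 = w0 / w2" by (rule sqrt_exists)
  have "pencil_equiv P (subst_pair (1, x, 0, 1) Q)"
    using assms(2) pencil_equiv_subst[of "(1, x, 0, 1)" Q] by (simp add: pencil_equiv_trans)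
  moreover have "wronsk (subst_pair (1, x, 0, 1) Q) = (0, w2, 0)"
    using wronsk_subst[OF assms(3) refl] assms(4) by (simp add: x)
  ultimately obtain g0 g1 \<beta> h0 h1 where *: "pencil_equiv P ((g0, g1, \<beta>, 1), (h0, h1, 0, 0))"
    "h0 \<noteq> \<beta> * h1" "g1 * h0 = g0 * h1"
    using pencil_equiv_root_at_infinity[OF assms(1)] assms(4) by metis
  have h0: "h0 \<noteq> 0"
  proof
    assume 0: "h0 = 0"
    then have "g0 = 0" using *(2,3) by auto
    then have "pencil_equiv P (lin_quad_mult (0, 1) (g1, \<beta>, 1), lin_quad_mult (0, 1) (h1, 0, 0))"
      using *(1) 0 by simp
    then show False using reduced_cubic_no_linear_factor[OF assms(1)] by fastforce
  qed
  note *(1)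
  also have "pencil_equiv ((g0, g1, \<beta>, 1), (h0, h1, 0, 0))
     (row_op (1, g0/h0, 0, 1/h0) ((g0, g1, \<beta>, 1), (h0, h1, 0, 0)))"
    by (rule pencil_equiv_row_op) (use h0 in simp)
  also have "row_op (1, g0/h0, 0, 1/h0) ((g0, g1, \<beta>, 1), (h0, h1, 0, 0)) = ((0, 0, \<beta>, 1), (1, h1/h0, 0, 0))"
    using h0 *(3) by (simp add: add_eq_0_iff2 eq_divide_eq)
  finally have eq: "pencil_equiv P \<dots>" .
  have "\<beta> * (h1/h0) \<noteq> 1" using h0 *(2) by (auto simp: eq_divide_eq)
  then obtain l where l: "l \<in> {Form_i, Form_iii} \<union> Form_v ` (- {0, 1})"
    "pencil_equiv ((0, 0, \<beta>, 1), (1, h1/h0, 0, 0)) (label_pencil \<sigma> \<theta> l)"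
    by (rule pencil_equiv_group_A)
  show thesis
    using l(1) by (intro that[OF _ pencil_equiv_trans[OF eq l(2)]]) auto
qed

text \<open>The double root of V is at infinity. Since \<open>w2 = 0\<close>, the denominator is
  \<open>h1 * (x + \<beta>)\<close>, and one translation by \<open>\<beta>\<close> removes both its
  constant term and the \<open>x^2\<close> term of the numerator, as
  \<open>3 * \<beta> + \<beta> = 0\<close>.\<close>

lemma label_exists_wild:
  fixes \<sigma> \<theta> :: 'a
  assumes theta: "(\<exists>m. CARD('a) = m^2) \<Longrightarrow> \<nexists>y. \<theta> = y^3"
    and "reduced_cubic P" "pencil_equiv P Q" "wronsk Q = (0, 0, w0)"
  obtains l where "admissible l" "pencil_equiv P (label_pencil \<sigma> \<theta> l)"
proof -
  obtain g0 g1 \<beta> h0 h1 where *: "pencil_equiv P ((g0, g1, \<beta>, 1), (h0, h1, 0, 0))"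
    "h0 = \<beta> * h1"
    using pencil_equiv_root_at_infinity[OF assms(2-4)] by metis
  have h1: "h1 \<noteq> 0"
    using reduced_cubic_not_proportional[OF assms(2)] * by fastforce
  define g0' g1' where "g0' = g0 + \<beta>*g1" and "g1' = \<beta>^2 + g1"
  note *(1)
  also have "pencil_equiv ((g0, g1, \<beta>, 1), (h0, h1, 0, 0)) (subst_pair (1, \<beta>, 0, 1) ((g0, g1, \<beta>, 1), (h0, h1, 0, 0)))"
    by (rule pencil_equiv_subst) simp
  also have "subst_pair (1, \<beta>, 0, 1) ((g0, g1, \<beta>, 1), (h0, h1, 0, 0)) = ((g0', g1', 0, 1), (0, h1, 0, 0))"
    by (simp add: subst_pair_def *(2) g0'_def g1'_def power2_eq_square power3_eq_cube algebra_simps)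
  also have "pencil_equiv \<dots> (row_op (1, g1'/h1, 0, 1/h1) \<dots>)"
    by (rule pencil_equiv_row_op) (use h1 in simp)
  also have "row_op (1, g1'/h1, 0, 1/h1) ((g0', g1', 0, 1), (0, h1, 0, 0)) = ((g0', 0, 0, 1), (0, 1, 0, 0))"
    using h1 by simp
  finally have eq: "pencil_equiv P ((g0', 0, 0, 1), (0, 1, 0, 0))" .
  have nz: "g0' \<noteq> 0"
  proof
    assume "g0' = 0"
    then have "pencil_equiv P (lin_quad_mult (0, 1) (0, 0, 1), lin_quad_mult (0, 1) (1, 0, 0))"
      using eq by simp
    then show False using reduced_cubic_no_linear_factor[OF assms(2)] by fastforce
  qed
  \<comment> \<open>Replacing \<open>x\<close> by \<open>y x\<close> and dividing by
    \<open>y^3\<close> shows that the constant matters only modulo cubes.\<close>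
  have scale: "pencil_equiv P ((\<kappa>, 0, 0, 1), (0, 1, 0, 0))" if "g0' = \<kappa> * y^3" "y \<noteq> 0" for \<kappa> y
  proof -
    have "((\<kappa>, 0, 0, 1), (0, 1, 0, 0)) = row_op (1/y^3, 0, 0, 1/y) (subst_pair (y, 0, 0, 1) ((g0', 0, 0, 1), (0, 1, 0, 0)))"
      using that by (simp add: subst_pair_def)
    moreover have "mat_det (1/y^3, 0, 0, 1/y) \<noteq> 0" "mat_det (y, 0, 0, 1) \<noteq> 0" using that by simp_all
    ultimately have "pencil_equiv ((g0', 0, 0, 1), (0, 1, 0, 0)) ((\<kappa>, 0, 0, 1), (0, 1, 0, 0))"
      unfolding pencil_equiv_def by blast
    with eq show ?thesis by (rule pencil_equiv_trans)
  qed
  show thesis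
  proof (cases "\<exists>m. CARD('a) = m^2")
    case True
    then obtain y where y: "y \<noteq> 0" "g0' = y^3 \<or> g0' = \<theta> * y^3 \<or> g0' = \<theta>^2 * y^3"
      using cube_classes[of \<theta> g0'] theta nz by metis
    then consider "g0' = 1 * y^3" | "g0' = \<theta> * y^3" | "g0' = \<theta>^2 * y^3" by auto
    then show thesis
    proof cases
      case 1
      from scale[OF this y(1)] show thesis by (intro that[of Form_iv]) simp_all
    next
      case 2
      from scale[OF this y(1)] show thesis using True by (intro that[of Form_iv_theta]) simp_all
    next
      case 3
      from scale[OF this y(1)] show thesis using True by (intro that[of Form_iv_theta2]) simp_all
    qed
  next
    case False
    then obtain y where y: "g0' = y^3" using nonsquare_card_cube by blast
    then have "y \<noteq> 0" using nz by auto
    from scale[of 1, OF _ this] y show thesis by (intro that[of Form_iv]) simp_all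
  qed
qed

end

section \<open>Conjugate roots of the Wronskian: the nonsplit case\<close>

context finite_field_char_2
begin

text \<open>The Wronskian determines \<open>h0\<close> and \<open>g0\<close> from \<open>g1\<close>,
  so one parameter is left. Adding \<open>b\<close> times the second form to the first, with
  \<open>b = g1 + \<sigma>\<close>, makes the coefficient of \<open>x\<close> equal to
  \<open>\<sigma>\<close>.\<close>

lemma label_exists_standard:
  fixes \<sigma> \<theta> :: 'a
  assumes "reduced_cubic P" "pencil_equiv P ((g0, g1, 0, 1), (h0, 1, 1, 0))"
    "wronsk ((g0, g1, 0, 1), (h0, 1, 1, 0)) = (1, 1, \<sigma>^2)"
  obtains l where "admissible l" "pencil_equiv P (label_pencil \<sigma> \<theta> l)"
proof -
  define b where "b = g1 + \<sigma>"
  have "h0 + g1 = 1" "g1 * h0 + g0 = \<sigma>^2" using assms(3) by simp_all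
  then have h0: "h0 = 1 + g1" and g0: "g0 = \<sigma>^2 + g1 * (1 + g1)"
    by (metis add.assoc add_self add_0_right add.commute)+
  note assms(2)
  also have "pencil_equiv ((g0, g1, 0, 1), (h0, 1, 1, 0)) (row_op (1, b, 0, 1) ((g0, g1, 0, 1), (h0, 1, 1, 0)))"
    by (rule pencil_equiv_row_op) simp
  also have "row_op (1, b, 0, 1) ((g0, g1, 0, 1), (h0, 1, 1, 0)) = label_pencil \<sigma> \<theta> (Form_vi b)"
    by (simp add: b_def h0 g0 power2_eq_square algebra_simps)
  finally have eq: "pencil_equiv P \<dots>" .
  consider "b = 0" | "b = 1" | "b \<notin> {0, 1}" by blast
  then show thesis
  proof cases
    case 1
    then show thesis using eq by (intro that[of Form_ii]) (simp_all add: add.commute)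
  next
    case 2
    \<comment> \<open>For \<open>b = 1\<close> the two forms are
      \<open>x (x^2 + x + \<sigma>)\<close> and \<open>x^2 + x + \<sigma>\<close>.\<close>
    then have "pencil_equiv P (lin_quad_mult (0, 1) (\<sigma>, 1, 1), lin_quad_mult (1, 0) (\<sigma>, 1, 1))"
      using eq by simp
    then show thesis using reduced_cubic_no_quadratic_factor[OF assms(1)] by blast
  next
    case 3
    then show thesis using eq by (intro that[of "Form_vi b"]) simp_all
  qed
qed

text \<open>The echelon entries do not involve \<open>p10\<close>; the Pluecker relation recovers
  it, and with it the last coefficient of the Wronskian.\<close>

lemma pencil_equiv_echelon_wronsk:
  fixes Q :: "'a quad \<times> 'a quad"
  assumes "minor Q = (m, p31, p30, p21, p20, p10)" "wronsk Q = (m, m, m*\<sigma>^2)" "m \<noteq> 0"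
  shows "pencil_equiv Q ((p20/m, p21/m, 0, 1), (p30/m, p31/m, 1, 0))"
    "wronsk ((p20/m, p21/m, 0, 1), (p30/m, p31/m, 1, 0)) = (1, 1, \<sigma>^2)"
proof -
  show "pencil_equiv Q ((p20/m, p21/m, 0, 1), (p30/m, p31/m, 1, 0))"
    by (rule pencil_equiv_echelon[OF assms(1,3)])
  have "(m, p30 + p21, p10) = (m, m, m*\<sigma>^2)"
    using minor_relation(2)[OF assms(1)] assms(2) by (rule trans[OF sym])
  then have "p30 + p21 = m" "p10 = m*\<sigma>^2" by blast+
  moreover have "m*p10 = p31*p20 + p30*p21" by (rule minor_relation(1)[OF assms(1)])
  ultimately have "p30/m + p21/m = 1" "p21/m*(p30/m) + p20/m*(p31/m) = \<sigma>^2"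
    using assms(3) by (simp_all add: field_simps power2_eq_square flip: add_divide_distrib)
  then show "wronsk ((p20/m, p21/m, 0, 1), (p30/m, p31/m, 1, 0)) = (1, 1, \<sigma>^2)" by simp
qed

text \<open>The substitution by \<open>(s, \<sigma>, 1, s + 1)\<close> is multiplication by \<open>s + \<omega>\<close> where \<open>\<omega>\<^sup>2 = \<omega> + \<sigma>\<close>, so it fixes
  the form \<open>x\<^sup>2 + x + \<sigma>\<close>. The value of \<open>s\<close> is determined by the requirement that the new pencil
  have equal coefficients \<open>p32\<close> and \<open>p31\<close>; this is a purely inseparable quadratic condition.\<close>

lemma label_exists_nonsplit_normalized:
  fixes \<sigma> \<theta> :: 'a
  assumes sigma: "\<And>y. y^2 + y \<noteq> \<sigma>"
    and P: "reduced_cubic P" "pencil_equiv P Q" "wronsk Q = (m, m, m*\<sigma>^2)" "m \<noteq> 0"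
  obtains l where "admissible l" "pencil_equiv P (label_pencil \<sigma> \<theta> l)"
proof -
  obtain m' p31 p30 p21 p20 p10 where p: "minor Q = (m', p31, p30, p21, p20, p10)"
    by (metis prod.collapse)
  have "m' = m" using minor_relation(2)[OF p] P(3) by simp
  note p = p[unfolded this]
  define g0 g1 h0 h1 where "g0 = p20/m" and "g1 = p21/m" and "h0 = p30/m" and "h1 = p31/m"
  define S :: "'a quad \<times> 'a quad" where "S = ((g0, g1, 0, 1), (h0, h1, 1, 0))"
  have eq: "pencil_equiv P S" and w: "wronsk S = (1, 1, \<sigma>^2)"
    using pencil_equiv_echelon_wronsk[OF p P(3,4)] pencil_equiv_trans[OF P(2)]
    unfolding S_def g0_def g1_def h0_def h1_def by auto
  show thesis
  proof (cases "h1 = 1")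
    case True
    then show thesis using label_exists_standard[OF P(1)] eq w that unfolding S_def by metis
  next
    case False
    then have nz: "h1 + 1 \<noteq> 0" by (simp add: add_eq_0_iff2)
    \<comment> \<open>The required equality of minors is implied by
      \<open>s^2 * (h1 + 1) = g0 + \<sigma>\<close>, solvable since every element is a square and
      \<open>h1\<close> is not 1.\<close>
    obtain s where "s^2 = (g0 + \<sigma>)/(h1 + 1)" by (rule sqrt_exists)
    then have "s^2*(h1 + 1) = g0 + \<sigma>" using nz by simp
    then have g0: "g0 = s^2*(h1 + 1) + \<sigma>" by (simp add: add.assoc)
    have "h0 + g1 = 1" using w by (simp add: S_def)
    then have h0: "h0 = g1 + 1" by (metis add.assoc add_self add_0_right add.commute)
    define M :: "'a quad" where "M = (s, \<sigma>, 1, s + 1)"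
    define k where "k = s^2 + s + \<sigma>"
    have k: "k \<noteq> 0" using sigma[of s] by (simp add: k_def add_eq_0_iff2)
    have det: "mat_det M = k" by (simp add: M_def k_def power2_eq_square algebra_simps)
    define Q' where "Q' = subst_pair M S"
    have eq': "pencil_equiv P Q'"
      unfolding Q'_def by (rule pencil_equiv_trans[OF eq pencil_equiv_subst]) (simp add: det k)
    \<comment> \<open>Values of \<open>x^4 + x^2 z^2 + \<sigma>^2 z^4\<close> at the two columns of
      \<open>M\<close>. Here \<open>k\<close> is the norm of \<open>s + \<omega>\<close>, so the
      quartic returns multiplied by \<open>k^2\<close>.\<close>
    have "s^4 + s^2 + \<sigma>^2 = k^2" "\<sigma>^4 + \<sigma>^2*(s + 1)^2 + \<sigma>^2*(s + 1)^4 = k^2*\<sigma>^2"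
      by (simp_all add: k_def eval_nat_numeral algebra_simps)
    then have w': "wronsk Q' = (k^3, k^3, k^3*\<sigma>^2)"
      unfolding Q'_def wronsk_subst[OF w M_def] det
      by (simp add: power2_eq_square power3_eq_cube mult_ac)
    obtain n q31 q30 q21 q20 q10 where q: "minor Q' = (n, q31, q30, q21, q20, q10)"
      by (metis prod.collapse)
    have "n = k^3" using minor_relation(2)[OF q] w' by simp
    note q = q[unfolded this]
    have "q31 = k^3"
      using q by (simp add: Q'_def S_def subst_pair_def M_def g0 h0 k_def)
        (simp add: algebra_simps eval_nat_numeral)
    then have q31: "q31/k^3 = 1" using k by simp
    note r = pencil_equiv_echelon_wronsk[OF q w', unfolded q31]
    show thesis
      by (rule label_exists_standard[OF P(1) pencil_equiv_trans[OF eq' r(1)] r(2) that]) (use k in simp_all)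
  qed
qed

text \<open>Taking square roots of the coefficients gives V itself. Its middle coefficient is
  nonzero, as otherwise its root would be a square root in the field. Scaling then brings V to
  Artin-Schreier shape \<open>y^2 + y + \<tau>\<close>, and a translation changes
  \<open>\<tau>\<close> into \<open>\<sigma>\<close>.\<close>

lemma label_exists_nonsplit:
  fixes \<sigma> \<theta> :: 'a
  assumes sigma: "\<And>y. y^2 + y \<noteq> \<sigma>"
    and P: "reduced_cubic P" "\<not> wronsk_has_root P"
  obtains l where "admissible l" "pencil_equiv P (label_pencil \<sigma> \<theta> l)"
proof -
  obtain w4 w2 w0 where w: "wronsk P = (w4, w2, w0)" by (metis prod.collapse)
  have no_root: "w4*x^4 + w2*x^2*z^2 + w0*z^4 \<noteq> 0" if "x \<noteq> 0 \<or> z \<noteq> 0" for x z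
    using P(2) that by (auto simp: wronsk_has_root_def w)
  obtain \<alpha> \<beta> \<gamma> where sq: "\<alpha>^2 = w4" "\<beta>^2 = w2" "\<gamma>^2 = w0" by (metis sqrt_exists)
  have V: "w4*x^4 + w2*x^2 + w0 = (\<alpha>*x^2 + \<beta>*x + \<gamma>)^2" for x
    by (simp add: add_square power_mult_distrib flip: sq power_mult)
  have V_nz: "\<alpha>*x^2 + \<beta>*x + \<gamma> \<noteq> 0" for x
    using no_root[of x 1] V[of x] by auto
  have \<alpha>: "\<alpha> \<noteq> 0" using no_root[of 1 0] sq(1) by auto
  have \<beta>: "\<beta> \<noteq> 0"
  proof
    assume "\<beta> = 0"
    obtain x where "x^2 = \<gamma>/\<alpha>" by (rule sqrt_exists)
    then show False using V_nz[of x] \<open>\<beta> = 0\<close> \<alpha> by simp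
  qed
  \<comment> \<open>\<open>\<mu>\<close> is the scaling that equalises the two leading coefficients
    of V; the resulting \<open>\<tau>\<close> is the Arf invariant of V.\<close>
  define \<mu> where "\<mu> = \<beta>/\<alpha>"
  define \<tau> where "\<tau> = \<alpha>*\<gamma>/\<beta>^2"
  have V_\<mu>: "\<alpha>*(\<mu>*y)^2 + \<beta>*(\<mu>*y) + \<gamma> = \<beta>^2/\<alpha>*(y^2 + y + \<tau>)" for y
    using \<alpha> \<beta> by (simp add: \<mu>_def \<tau>_def field_simps power2_eq_square)
  have "y^2 + y \<noteq> \<tau>" for y
    using V_nz[of "\<mu>*y"] unfolding V_\<mu> by auto
  then obtain y where y: "y^2 + y = \<sigma> + \<tau>" using artin_schreier_index_2[of \<sigma> \<tau>] sigma by blast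
  then have y\<tau>: "y^2 + y + \<tau> = \<sigma>" by (simp add: add.assoc)
  define M :: "'a quad" where "M = (\<mu>, \<mu>*y, 0, 1 :: 'a)"
  define m where "m = \<mu>*(\<beta>^2/\<alpha>)^2"
  have \<mu>: "\<mu> \<noteq> 0" using \<alpha> \<beta> by (simp add: \<mu>_def)
  have "w4*\<mu>^4 = (\<beta>^2/\<alpha>)^2" "\<mu>^2*w2 = (\<beta>^2/\<alpha>)^2"
    using \<alpha> by (simp_all add: \<mu>_def field_simps eval_nat_numeral flip: sq)
  moreover have "w4*(\<mu>*y)^4 + w2*(\<mu>*y)^2 + w0 = (\<beta>^2/\<alpha>)^2*\<sigma>^2"
    unfolding V V_\<mu> y\<tau> by (rule power_mult_distrib)
  ultimately have "wronsk (subst_pair M P) = (m, m, m*\<sigma>^2)"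
    unfolding wronsk_subst[OF w M_def]
    by (simp add: M_def m_def power3_eq_cube power2_eq_square mult.assoc)
  moreover have "m \<noteq> 0" using \<alpha> \<beta> \<mu> by (simp add: m_def)
  moreover have "pencil_equiv P (subst_pair M P)"
    by (rule pencil_equiv_subst) (simp add: M_def \<mu>)
  ultimately show thesis
    using label_exists_nonsplit_normalized[OF sigma P(1)] that by blast
qed

lemma label_exists:
  fixes \<sigma> \<theta> :: 'a
  assumes sigma: "\<And>y. y^2 + y \<noteq> \<sigma>"
    and theta: "(\<exists>m. CARD('a) = m^2) \<Longrightarrow> \<nexists>y. \<theta> = y^3"
    and P: "reduced_cubic P"
  obtains l where "admissible l" "pencil_equiv P (label_pencil \<sigma> \<theta> l)"
proof (cases "wronsk_has_root P")
  case False
  then show thesis using label_exists_nonsplit[OF sigma P] that by blast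
next
  case True
  obtain w4 w2 w0 where w: "wronsk P = (w4, w2, w0)" by (metis prod.collapse)
  obtain x z where xz: "x \<noteq> 0 \<or> z \<noteq> 0" "w4*x^4 + w2*x^2*z^2 + w0*z^4 = 0"
    using True by (auto simp: wronsk_has_root_def w)
  \<comment> \<open>The first column is the root, so the substitution carries infinity to it; the
    second column merely makes the matrix invertible.\<close>
  define M :: "'a quad" where "M = (x, if x = 0 then 1 else 0, z, if x = 0 then 0 else 1)"
  have det: "mat_det M \<noteq> 0" using xz(1) by (simp add: M_def)
  define Q where "Q = subst_pair M P"
  have eq: "pencil_equiv P Q" unfolding Q_def by (rule pencil_equiv_subst[OF det])
  obtain v4 v2 v0 where v: "wronsk Q = (v4, v2, v0)" by (metis prod.collapse)
  have "v4 = 0" using wronsk_subst[OF w M_def] v xz(2) by (simp add: Q_def)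
  then show thesis
    using label_exists_split[OF P eq] label_exists_wild[OF theta P eq] v that by blast
qed

end

section \<open>Ramification\<close>

lemma coprime_of_const_remainder:
  fixes g h q :: "'a::field poly"
  assumes "g = q * h + [:r:]" "r \<noteq> 0"
  shows "coprime g h"
proof (rule coprimeI)
  fix k assume "k dvd g" "k dvd h"
  then have "k dvd g - q * h" by (intro dvd_diff dvd_mult)
  also have "g - q * h = [:r:]" by (simp add: assms(1))
  finally show "is_unit k"
    using assms(2) by (meson dvd_trans is_unit_const_poly_iff dvd_field_iff)
qed

section \<open>Fibres over the algebraic closure\<close>

definition eval_ac :: "'a::field poly \<Rightarrow> 'a alg_closure \<Rightarrow> 'a alg_closure" where
  "eval_ac p a = poly (map_poly to_ac p) a"

lemma eval_ac_0 [simp]: "eval_ac 0 a = 0"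
  by (simp add: eval_ac_def)

lemma eval_ac_pCons [simp]: "eval_ac (pCons c p) a = to_ac c + a * eval_ac p a"
  by (simp add: eval_ac_def map_poly_pCons)

lemma eval_ac_add: "eval_ac (p + q) a = eval_ac p a + eval_ac q a"
  by (induction p q rule: poly_induct2) (simp_all add: algebra_simps)

lemma eval_ac_smult: "eval_ac (Polynomial.smult c p) a = to_ac c * eval_ac p a"
  by (induction p) (simp_all add: algebra_simps)

lemma eval_ac_mult: "eval_ac (p * q) a = eval_ac p a * eval_ac q a"
  by (induction p) (simp_all add: algebra_simps eval_ac_add eval_ac_smult)

text \<open>A Bezout identity over the base field remains valid at every point of the
  closure.\<close>

lemma coprime_no_common_root:
  assumes "coprime p q"
  shows "eval_ac p a \<noteq> 0 \<or> eval_ac q a \<noteq> 0"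
proof -
  obtain u v where "u * p + v * q = 1" by (rule coprime_poly_bezout[OF assms])
  then have "eval_ac u a * eval_ac p a + eval_ac v a * eval_ac q a = 1"
    by (simp add: one_pCons flip: eval_ac_mult eval_ac_add)
  then show ?thesis by auto
qed

lemma reduced_cubic_numer_denom_ac:
  assumes "reduced_cubic (g, h)"
  obtains c where "c \<noteq> 0" "rat_degree (pencil_fract (g, h)) = 3"
    "numer_ac (pencil_fract (g, h)) = Polynomial.smult c (map_poly to_ac (cubic_poly g))"
    "denom_ac (pencil_fract (g, h)) = Polynomial.smult c (map_poly to_ac (cubic_poly h))"
proof -
  have gh: "cubic_poly h \<noteq> 0" "coprime (cubic_poly g) (cubic_poly h)"
    "max (Polynomial.degree (cubic_poly g)) (Polynomial.degree (cubic_poly h)) = 3"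
    using assms by (auto simp: reduced_cubic_def)
  obtain c where c: "c \<noteq> 0" "numer (pencil_fract (g, h)) = Polynomial.smult c (cubic_poly g)"
    "denom (pencil_fract (g, h)) = Polynomial.smult c (cubic_poly h)"
    unfolding pencil_fract_def fst_conv snd_conv by (rule numer_denom_Fract[OF gh(1,2)])
  show thesis
    by (rule that[of "to_ac c"])
      (use c gh in \<open>simp_all add: numer_ac_def denom_ac_def rat_degree_def map_poly_smult\<close>)
qed

text \<open>Unlike \<^const>\<open>fibre_poly\<close>, this form of the fibre through \<open>a\<close> is uniform in whether \<open>a\<close> is a pole.\<close>

lemma ram_index_Fin:
  fixes g h :: "'a::field quad"
  assumes "reduced_cubic (g, h)"
  defines "G \<equiv> map_poly to_ac (cubic_poly g)" and "H \<equiv> map_poly to_ac (cubic_poly h)"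
  shows "ram_index (pencil_fract (g, h)) (Fin a) =
    Polynomial.order a (Polynomial.smult (poly H a) G - Polynomial.smult (poly G a) H)"
proof -
  obtain c where c: "c \<noteq> 0"
    "numer_ac (pencil_fract (g, h)) = Polynomial.smult c G" "denom_ac (pencil_fract (g, h)) = Polynomial.smult c H"
    using reduced_cubic_numer_denom_ac[OF assms(1)] unfolding G_def H_def by metis
  have GH: "poly G a \<noteq> 0 \<or> poly H a \<noteq> 0"
    using assms(1) coprime_no_common_root[of "cubic_poly g" "cubic_poly h" a]
    by (simp add: reduced_cubic_def eval_ac_def G_def H_def)
  show ?thesis
  proof (cases "poly H a = 0")
    case True
    then have "poly G a \<noteq> 0" using GH by simp
    then have "Polynomial.order a (- Polynomial.smult (poly G a) H) = Polynomial.order a H"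
      unfolding order_uminus by (rule order_smult)
    then show ?thesis using True c by (simp add: ram_index_def rat_map_def fibre_poly_def order_smult)
  next
    case False
    have "Polynomial.smult c G - Polynomial.smult (poly G a / poly H a) (Polynomial.smult c H) =
        Polynomial.smult (c / poly H a) (Polynomial.smult (poly H a) G - Polynomial.smult (poly G a) H)"
      using False by (simp add: smult_diff_right mult.commute)
    then show ?thesis using False c by (simp add: ram_index_def rat_map_def fibre_poly_def order_smult)
  qed
qed

text \<open>The vanishing coefficient of index 3 in the denominator makes infinity a pole, so its
  fibre is \<open>h\<close>, read as a form of degree 3.\<close>

lemma ram_index_Infty:
  fixes g h :: "'a::field quad"
  assumes "reduced_cubic (g, h)" "Polynomial.degree (cubic_poly h) < 3"
  shows "ram_index (pencil_fract (g, h)) Infty = 3 - Polynomial.degree (cubic_poly h)"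
proof -
  obtain c where c: "c \<noteq> 0" "rat_degree (pencil_fract (g, h)) = 3"
    "denom_ac (pencil_fract (g, h)) = Polynomial.smult c (map_poly to_ac (cubic_poly h))"
    using reduced_cubic_numer_denom_ac[OF assms(1)] by metis
  have "Polynomial.coeff (cubic_poly h) 3 = 0" using assms(2) by (rule coeff_eq_0)
  then show ?thesis
    using c by (simp add: ram_index_def rat_map_def fibre_poly_def coeff_map_poly degree_map_poly)
qed

lemma order_ge_2_imp_pderiv_root:
  fixes p :: "'a::field poly"
  assumes "Polynomial.order a p > 1"
  shows "poly (pderiv p) a = 0"
proof -
  have "[:-a, 1:]^2 dvd p" using assms by (subst order_divides) simp
  then obtain q where q: "p = [:-a, 1:]^2 * q" by (rule dvdE)
  define u where "u = [:-a, 1:]"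
  have "p = u * (u * q)" unfolding q u_def by (simp only: power2_eq_square mult.assoc)
  moreover have "poly u a = 0" by (simp add: u_def)
  ultimately show ?thesis by (simp add: pderiv_mult)
qed

context field_char_2
begin

lemma field_char_2_alg_closure: "field_char_2 TYPE('a alg_closure)"
  by standard (simp add: CHAR_2)

lemma order_cubic:
  fixes a e k :: 'a
  assumes "k \<noteq> 0"
  shows "Polynomial.order a (Polynomial.smult k ([:a, 1:]^2 * [:e, 1:])) = (if e = a then 3 else 2)"
proof -
  have nz: "[:a, 1:]^2 * [:e, 1:] \<noteq> 0" by (intro no_zero_divisors power_not_zero) simp_all
  have 2: "Polynomial.order a ([:a, 1:]^2) = 2" using order_power_n_n[of a 2] by simp
  have "Polynomial.order a [:e, 1:] = (if e = a then 1 else 0)"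
    using order_power_n_n[of a 1] by (auto intro!: order_0I simp: add_eq_0_iff2)
  then show ?thesis using order_mult[OF nz, of a] 2 assms by (simp add: order_smult)
qed

text \<open>\<open>e\<close> is the third point of the fibre through \<open>a\<close>, so the index
  is 3 exactly when it coincides with \<open>a\<close>. The factor \<open>k\<close> is the leading
  coefficient, the value of the denominator at \<open>a\<close>.\<close>

lemma ram_index_Fin_factor:
  assumes "reduced_cubic ((g0, g1, g2, 1), (h0, h1, h2, 0 :: 'a))" "k \<noteq> 0"
    and "Polynomial.smult (poly [:to_ac h0, to_ac h1, to_ac h2:] a) [:to_ac g0, to_ac g1, to_ac g2, 1:]
       - Polynomial.smult (poly [:to_ac g0, to_ac g1, to_ac g2, 1:] a) [:to_ac h0, to_ac h1, to_ac h2:]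
      = Polynomial.smult k ([:a, 1:]^2 * [:e, 1:])"
  shows "ram_index (pencil_fract ((g0, g1, g2, 1), (h0, h1, h2, 0))) (Fin a) = (if e = a then 3 else 2)"
proof -
  interpret K: field_char_2 "TYPE('a alg_closure)" by (rule field_char_2_alg_closure)
  have "map_poly to_ac (cubic_poly (g0, g1, g2, 1)) = [:to_ac g0, to_ac g1, to_ac g2, 1:]"
    "map_poly to_ac (cubic_poly (h0, h1, h2, 0)) = [:to_ac h0, to_ac h1, to_ac h2:]"
    by (simp_all add: map_poly_pCons)
  then show ?thesis
    unfolding ram_index_Fin[OF assms(1)] using assms(3) K.order_cubic[OF assms(2)] by (simp only:)
qed

text \<open>A multiple point of the fibre kills the derivative of the fibre polynomial, and that
  derivative at \<open>a\<close> is the Wronskian at \<open>a\<close>.\<close>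

lemma ram_index_Fin_wronsk:
  assumes "reduced_cubic ((g0, g1, g2, 1), (h0, h1, h2, 0 :: 'a))"
    and "ram_index (pencil_fract ((g0, g1, g2, 1), (h0, h1, h2, 0))) (Fin a) > 1"
    and "wronsk ((g0, g1, g2, 1), (h0, h1, h2, 0)) = (w4, w2, w0)"
  shows "to_ac w4 * a^4 + to_ac w2 * a^2 + to_ac w0 = 0"
proof -
  interpret K: field_char_2 "TYPE('a alg_closure)" by (rule field_char_2_alg_closure)
  let ?G = "[:to_ac g0, to_ac g1, to_ac g2, 1:]" and ?H = "[:to_ac h0, to_ac h1, to_ac h2:]"
  have eq: "map_poly to_ac (cubic_poly (g0, g1, g2, 1)) = ?G"
    "map_poly to_ac (cubic_poly (h0, h1, h2, 0)) = ?H"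
    by (simp_all add: map_poly_pCons)
  have "poly (pderiv (Polynomial.smult (poly ?H a) ?G - Polynomial.smult (poly ?G a) ?H)) a = 0"
    using assms(2) unfolding ram_index_Fin[OF assms(1)] eq by (rule order_ge_2_imp_pderiv_root)
  also have "poly (pderiv (Polynomial.smult (poly ?H a) ?G - Polynomial.smult (poly ?G a) ?H)) a =
      to_ac w4 * a^4 + to_ac w2 * a^2 + to_ac w0"
    unfolding pderiv_diff pderiv_smult poly_diff poly_smult
    using assms(3) by (auto simp: pderiv_pCons eval_nat_numeral algebra_simps)
  finally show ?thesis .
qed

end

lemma ram_indices_eqI:
  assumes "\<And>Q. ram_index R Q > 1 \<longleftrightarrow> Q \<in> A"
  shows "ram_indices R = image_mset (ram_index R) (mset_set A)"
  using assms by (simp add: ram_indices_def)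

lemma ram_indices_Fin_Infty:
  assumes "\<And>x. ram_index R (Fin x) > 1 \<Longrightarrow> x = a"
    and "ram_index R (Fin a) = m" "m > 1" "ram_index R Infty = n" "n > 1"
  shows "ram_indices R = {#m, n#}"
proof -
  have "ram_index R Q > 1 \<longleftrightarrow> Q \<in> {Fin a, Infty}" for Q
    using assms by (cases Q) auto
  then have "ram_indices R = image_mset (ram_index R) (mset_set {Fin a, Infty})"
    by (rule ram_indices_eqI)
  then show ?thesis using assms by simp
qed

section \<open>Coprimality and ramification of the normal forms\<close>

context finite_field_char_2
begin

text \<open>One Euclidean division suffices for every normal form; the constant remainder vanishes
  exactly at the parameters where the two forms acquire a common factor.\<close>

lemma reduced_cubicI:
  fixes g0 g1 g2 h0 h1 h2 :: 'a
  assumes "cubic_poly (g0, g1, g2, 1) = q * [:h0, h1, h2:] + [:r:]" "r \<noteq> 0" "[:h0, h1, h2:] \<noteq> 0"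
  shows "reduced_cubic ((g0, g1, g2, 1), (h0, h1, h2, 0))"
  using coprime_of_const_remainder[OF assms(1,2)] assms(3) by (simp add: reduced_cubic_def)

lemma reduced_cubic_vi:
  fixes b \<sigma> :: 'a
  assumes "b \<noteq> 1"
  shows "reduced_cubic (((b + 1) * \<sigma>, \<sigma>, b, 1), (b + 1 + \<sigma>, 1, 1, 0))"
proof (rule reduced_cubicI)
  show "cubic_poly ((b + 1) * \<sigma>, \<sigma>, b, 1) = [:b + 1, 1:] * [:b + 1 + \<sigma>, 1, 1:] + [:(b + 1)^2:]"
    by (simp add: power2_eq_square algebra_simps)
  show "(b + 1)^2 \<noteq> 0" using assms by (simp add: add_eq_0_iff2)
qed simp

lemma reduced_cubic_v:
  fixes c :: 'a
  assumes "c \<noteq> 0" "c \<noteq> 1"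
  shows "reduced_cubic ((c, 0, 0, 1), (c, 1, 0, 0))"
proof (rule reduced_cubicI)
  show "cubic_poly (c, 0, 0, 1) = [:c^2, c, 1:] * [:c, 1, 0:] + [:c * (c + 1)^2:]"
    by (simp add: power2_eq_square algebra_simps)
  show "c * (c + 1)^2 \<noteq> 0" using assms by (simp add: add_eq_0_iff2)
qed simp

lemma reduced_cubic_iv:
  fixes \<zeta> :: 'a
  assumes "\<zeta> \<noteq> 0"
  shows "reduced_cubic ((\<zeta>, 0, 0, 1), (0, 1, 0, 0))"
  by (rule reduced_cubicI[where q = "[:0, 0, 1:]" and r = \<zeta>]) (use assms in simp_all)

lemma reduced_cubic_polynomial:
  fixes b :: 'a
  shows "reduced_cubic ((0, 0, b, 1), (1, 0, 0, 0))"
  by (rule reduced_cubicI[where q = "[:1, 0, b, 1:]" and r = 1]) simp_all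

text \<open>The ramification points are the roots \<open>r\<close> and \<open>r + 1\<close> of
  \<open>x^2 + x + \<sigma>\<close>. The fibre through such a root \<open>a\<close> is
  \<open>(x + a)^2 (x + a + b)\<close>, so both indices are 3 for \<open>b = 0\<close>, which is
  form (ii), and 2 otherwise.\<close>

lemma ram_indices_vi:
  fixes b \<sigma> :: 'a
  assumes "b \<noteq> 1"
  shows "ram_indices (pencil_fract (((b + 1) * \<sigma>, \<sigma>, b, 1), (b + 1 + \<sigma>, 1, 1, 0))) =
    (if b = 0 then {#3, 3#} else {#2, 2#})"
proof -
  interpret K: field_char_2 "TYPE('a alg_closure)" by (rule field_char_2_alg_closure)
  note red = reduced_cubic_vi[OF assms, of \<sigma>]
  let ?R = "pencil_fract (((b + 1) * \<sigma>, \<sigma>, b, 1), (b + 1 + \<sigma>, 1, 1, 0))"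
  define s where "s = to_ac \<sigma>"
  define B where "B = to_ac b"
  obtain r where r: "poly [:s, 1, 1:] r = 0"
    using alg_closed_imp_poly_has_root[of "[:s, 1, 1:]"] by auto
  have "s + (r^2 + r) = poly [:s, 1, 1:] r" by (simp add: power2_eq_square algebra_simps)
  then have s: "s = r^2 + r" using r by (metis K.add_eq_0_iff2)
  have root_iff: "x^2 + x + s = 0 \<longleftrightarrow> x = r \<or> x = r + 1" for x
  proof -
    have "x^2 + x + s = (x + r) * (x + (r + 1))" by (simp add: s power2_eq_square algebra_simps)
    then show ?thesis by (simp only: mult_eq_0_iff K.add_eq_0_iff2)
  qed
  have B: "B + 1 \<noteq> 0" using assms by (simp add: B_def K.add_eq_0_iff2)
  have fin: "ram_index ?R (Fin a) = (if b = 0 then 3 else 2)" if "a^2 + a + s = 0" for a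
  proof -
    have s': "s = a^2 + a" using that by (simp add: K.add_eq_0_iff2)
    have "ram_index ?R (Fin a) = (if a + B = a then 3 else 2)"
      by (rule ram_index_Fin_factor[OF red B])
        (simp add: s' power2_eq_square algebra_simps flip: s_def B_def)
    then show ?thesis by (simp add: B_def)
  qed
  have inf: "ram_index ?R Infty = 1" using ram_index_Infty[OF red] by simp
  have wr: "wronsk (((b + 1) * \<sigma>, \<sigma>, b, 1), (b + 1 + \<sigma>, 1, 1, 0)) = (1, 1, \<sigma>^2)"
    by (simp add: power2_eq_square algebra_simps)
  have "ram_index ?R Q > 1 \<longleftrightarrow> Q \<in> {Fin r, Fin (r + 1)}" for Q
  proof (cases Q)
    case (Fin x)
    have "x^2 + x + s = 0" if "ram_index ?R (Fin x) > 1"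
    proof -
      have "(x^2 + x + s)^2 = x^4 + x^2 + s^2"
        by (simp add: K.add_square flip: power_mult)
      also have "\<dots> = 0" using ram_index_Fin_wronsk[OF red that wr] by (simp add: s_def)
      finally show ?thesis by simp
    qed
    then show ?thesis using fin[of x] root_iff[of x] by (auto simp: Fin split: if_splits)
  qed (simp add: inf)
  then have "ram_indices ?R = image_mset (ram_index ?R) (mset_set {Fin r, Fin (r + 1)})"
    by (rule ram_indices_eqI)
  then show ?thesis using fin[of r] fin[of "r + 1"] root_iff by auto
qed

text \<open>The Wronskian is the nonzero constant \<open>\<zeta>\<close>, so no finite point
  ramifies; at infinity the linear denominator gives index 2.\<close>

lemma ram_indices_iv:
  fixes \<zeta> :: 'a
  assumes "\<zeta> \<noteq> 0"
  shows "ram_indices (pencil_fract ((\<zeta>, 0, 0, 1), (0, 1, 0, 0))) = {#2#}"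
proof -
  note red = reduced_cubic_iv[OF assms]
  have "ram_index (pencil_fract ((\<zeta>, 0, 0, 1), (0, 1, 0, 0))) Infty = 2"
    using ram_index_Infty[OF red] by simp
  moreover have "\<not> ram_index (pencil_fract ((\<zeta>, 0, 0, 1), (0, 1, 0, 0))) (Fin a) > 1" for a
    using ram_index_Fin_wronsk[OF red, of a 0 0 \<zeta>] assms by auto
  ultimately have "ram_index (pencil_fract ((\<zeta>, 0, 0, 1), (0, 1, 0, 0))) Q > 1 \<longleftrightarrow> Q \<in> {Infty}" for Q
    by (cases Q) auto
  then have "ram_indices (pencil_fract ((\<zeta>, 0, 0, 1), (0, 1, 0, 0))) =
      image_mset (ram_index (pencil_fract ((\<zeta>, 0, 0, 1), (0, 1, 0, 0)))) (mset_set {Infty})"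
    by (rule ram_indices_eqI)
  then show ?thesis using ram_index_Infty[OF red] by simp
qed

lemma ram_indices_v:
  fixes c :: 'a
  assumes "c \<noteq> 0" "c \<noteq> 1"
  shows "ram_indices (pencil_fract ((c, 0, 0, 1), (c, 1, 0, 0))) = {#2, 2#}"
proof -
  interpret K: field_char_2 "TYPE('a alg_closure)" by (rule field_char_2_alg_closure)
  note red = reduced_cubic_v[OF assms]
  define C where "C = to_ac c"
  have C: "1 + C \<noteq> 0" "C \<noteq> 0" using assms by (simp_all add: C_def K.add_eq_0_iff2 eq_commute[of 1])
  show ?thesis
  proof (rule ram_indices_Fin_Infty)
    fix x assume "1 < ram_index (pencil_fract ((c, 0, 0, 1), (c, 1, 0, 0))) (Fin x)"
    then have "C * x^2 + C = 0" using ram_index_Fin_wronsk[OF red, of x 0 c c] by (simp add: C_def)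
    then have "x^2 = 1^2" using C(2) by (simp add: K.add_eq_0_iff2)
    then show "x = 1" by (simp only: K.square_eq_iff_eq)
  next
    \<comment> \<open>The fibre through 1 is \<open>x (x + 1)^2\<close> up to the factor
      \<open>1 + c\<close>, so its third point is 0.\<close>
    have "ram_index (pencil_fract ((c, 0, 0, 1), (c, 1, 0, 0))) (Fin 1) = (if 0 = (1 :: 'a alg_closure) then 3 else 2)"
      by (rule ram_index_Fin_factor[OF red C(1)])
        (simp add: power2_eq_square algebra_simps flip: C_def)
    then show "ram_index (pencil_fract ((c, 0, 0, 1), (c, 1, 0, 0))) (Fin 1) = 2" by simp
  qed (use ram_index_Infty[OF red] in simp_all)
qed

text \<open>The parameters \<open>b = 0\<close> and \<open>b = 1\<close> give (i) and (iii). The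
  fibre through 0 is \<open>x^2 (x + b)\<close>, and every cubic polynomial is totally ramified at
  infinity.\<close>

lemma ram_indices_polynomial:
  fixes b :: 'a
  shows "ram_indices (pencil_fract ((0, 0, b, 1), (1, 0, 0, 0))) = {#if b = 0 then 3 else 2, 3#}"
proof -
  interpret K: field_char_2 "TYPE('a alg_closure)" by (rule field_char_2_alg_closure)
  note red = reduced_cubic_polynomial[of b]
  show ?thesis
  proof (rule ram_indices_Fin_Infty)
    fix x assume "1 < ram_index (pencil_fract ((0, 0, b, 1), (1, 0, 0, 0))) (Fin x)"
    then show "x = 0" using ram_index_Fin_wronsk[OF red, of x 0 1 0] by simp
  next
    have "ram_index (pencil_fract ((0, 0, b, 1), (1, 0, 0, 0))) (Fin 0) = (if to_ac b = 0 then 3 else 2)"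
      by (rule ram_index_Fin_factor[OF red, where k = 1]) (simp_all add: power2_eq_square)
    then show "ram_index (pencil_fract ((0, 0, b, 1), (1, 0, 0, 0))) (Fin 0) = (if b = 0 then 3 else 2)" by simp
  qed (use ram_index_Infty[OF red] in simp_all)
qed

end

theorem theorem7p2:
  fixes \<sigma> \<theta> :: "'a::{finite,field}"
  assumes "CHAR('a) = 2"
    and "abs_trace \<sigma> = 1"
    and "(\<exists>m. CARD('a) = m ^ 2) \<Longrightarrow> \<not> (\<exists>y. \<theta> = y ^ 3)"
  shows "(\<forall>R :: 'a poly fract. rat_degree R = 3 \<longrightarrow>
            (\<exists>!l. admissible l \<and> rat_equivalent R (representative \<sigma> \<theta> l))) \<and>
         (\<forall>l. admissible l \<longrightarrow> ram_indices (representative \<sigma> \<theta> l) = listed_indices l)"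
proof -
  interpret finite_field_char_2 "TYPE('a)" by standard (rule assms(1))
  have sigma: "y^2 + y \<noteq> \<sigma>" for y
    using abs_trace_artin_schreier[of y] assms(2) by auto
  have theta: "\<theta> \<noteq> 0" if "\<exists>m. CARD('a) = m^2"
    using assms(3)[OF that] by (metis power_zero_numeral)
  \<comment> \<open>Form (ii) is covered by (vi) at \<open>b = 0\<close>, forms (i) and (iii) by
    \<open>x^3 + b x^2\<close>, and all of (iv) by a nonzero constant, for which
    \<open>\<theta>\<close> must not be the cube 0.\<close>
  have red: "reduced_cubic (label_pencil \<sigma> \<theta> l)" if "admissible l" for l
    using that theta reduced_cubic_vi[of 0 \<sigma>] reduced_cubic_polynomial[of 0] reduced_cubic_polynomial[of 1]
    by (cases l) (simp_all add: reduced_cubic_vi reduced_cubic_v reduced_cubic_iv add.commute[of \<sigma> 1])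
  have ram: "ram_indices (representative \<sigma> \<theta> l) = listed_indices l" if "admissible l" for l
    using that theta ram_indices_vi[of 0 \<sigma>] ram_indices_polynomial[of 0] ram_indices_polynomial[of 1]
    unfolding representative_label_pencil
    by (cases l) (simp_all add: ram_indices_vi ram_indices_v ram_indices_iv add.commute[of \<sigma> 1])
  have "\<exists>!l. admissible l \<and> rat_equivalent R (representative \<sigma> \<theta> l)"
    if R: "rat_degree R = 3" for R :: "'a poly fract"
  proof -
    obtain P where P: "reduced_cubic P" "R = pencil_fract P" by (rule degree_3_pencil[OF R])
    have equiv: "rat_equivalent R (representative \<sigma> \<theta> l) \<longleftrightarrow> pencil_equiv P (label_pencil \<sigma> \<theta> l)"
      if "admissible l" for l
      unfolding P(2) representative_label_pencil
      by (rule rat_equivalent_pencil_fract[OF P(1) red[OF that]])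
    obtain l where l: "admissible l" "pencil_equiv P (label_pencil \<sigma> \<theta> l)"
      using label_exists[OF sigma assms(3) P(1)] by blast
    show ?thesis
    proof (rule ex1I)
      show "admissible l \<and> rat_equivalent R (representative \<sigma> \<theta> l)" using l equiv by blast
      fix l' assume "admissible l' \<and> rat_equivalent R (representative \<sigma> \<theta> l')"
      then have l': "admissible l'" "pencil_equiv P (label_pencil \<sigma> \<theta> l')" using equiv by blast+
      show "l' = l"
        by (rule label_unique[OF sigma assms(3) l'(1) l(1) pencil_equiv_trans[OF pencil_equiv_sym[OF l'(2)] l(2)]])
    qed
  qed
  with ram show ?thesis by blast
qed

end
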